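(* Let $q \ge 2$ be an integer. Suppose that $\chi(\mathrm{KG}^q(n,k)_{\widetilde{q\text{-stab}}}) = \left\lceil \frac{n - q(k-1)}{q-1} \right\rceil$ for all integers $k \ge 1$ and $n \ge qk$. Then for every path $P$ whose vertex set is partitioned into $m$ subsets $V_1, \dots, V_m$ of sizes at least $q-1$, there exist pairwise disjoint $q$-stable sets $S_1, \dots, S_q$ covering all but at most $q-1$ vertices of each $V_j$ and satisfying $|S_i \cap V_j| \ge \lfloor \frac{|V_j|+1}{q} \rfloor - 1$ for all $i \in \{1, \dots, q\}$ and $j \in \{1, \dots, m\}$. Moreover, for every $q$ that is a power of two, for every such path and partition there exist pairwise disjoint $q$-stable sets $S_1, \dots, S_q$ with these properties whose cardinalities additionally differ pairwise by at most one.
   Context: A set $S$ of vertices of a path is $q$-stable if any two distinct vertices of $S$ are at distance at least $q$ in the path. $\mathrm{KG}^q(n,k)_{\widetilde{q\text{-stab}}}$ is the $q$-uniform hypergraph whose vertices are the $k$-element subsets $F \subseteq \{1, \dots, n\}$ that are $q$-stable in the path $1 - 2 - \dots - n$ (i.e. any two distinct elements of $F$ differ by at least $q$), and whose hyperedges are the sets $\{F_1, \dots, F_q\}$ of $q$ pairwise disjoint such vertices. The (weak) chromatic number $\chi(H)$ of a hypergraph $H$ is the least number of colors in a coloring of its vertices such that no hyperedge is monochromatic. *)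

theory Defs
  imports Complex_Main "HOL-Library.Disjoint_Sets"
begin

text \<open>A path is given by the list of its vertices in order, assumed \<open>distinct\<close>
  wherever it is used.\<close>

definition path_adj :: "'a list \<Rightarrow> 'a \<Rightarrow> 'a \<Rightarrow> bool" where
  "path_adj p u v \<longleftrightarrow> (\<exists>i. Suc i < length p \<and> {u, v} = {p ! i, p ! Suc i})"

text \<open>Graph distance: the least length of a walk. Only meaningful for two vertices of the path.\<close>

definition path_dist :: "'a list \<Rightarrow> 'a \<Rightarrow> 'a \<Rightarrow> nat" where
  "path_dist p u v = (LEAST l. (path_adj p ^^ l) u v)"

definition stable_in_path :: "nat \<Rightarrow> 'a list \<Rightarrow> 'a set \<Rightarrow> bool" where
  "stable_in_path q p S \<longleftrightarrow>
     S \<subseteq> set p \<and> (\<forall>u\<in>S. \<forall>v\<in>S. u \<noteq> v \<longrightarrow> q \<le> path_dist p u v)"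

lemma path_adj_nth:
  assumes "distinct p" "i < length p"
  shows "path_adj p (p ! i) v \<longleftrightarrow> (\<exists>j < length p. v = p ! j \<and> (j = Suc i \<or> i = Suc j))"
proof
  assume "path_adj p (p ! i) v"
  then obtain k where k: "Suc k < length p" "{p ! i, v} = {p ! k, p ! Suc k}"
    unfolding path_adj_def by blast
  then consider "p ! i = p ! k" "v = p ! Suc k" | "p ! i = p ! Suc k" "v = p ! k"
    by (auto simp: doubleton_eq_iff)
  then show "\<exists>j < length p. v = p ! j \<and> (j = Suc i \<or> i = Suc j)"
  proof cases
    case 1
    then show ?thesis using assms k nth_eq_iff_index_eq[of p i k] by auto
  next
    case 2
    then show ?thesis using assms k nth_eq_iff_index_eq[of p i "Suc k"] Suc_lessD by blast
  qed
next
  assume "\<exists>j < length p. v = p ! j \<and> (j = Suc i \<or> i = Suc j)"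
  then show "path_adj p (p ! i) v"
    unfolding path_adj_def using assms by (auto simp: insert_commute)
qed

lemma path_walk_length_ge:
  assumes "distinct p" "i < length p" "(path_adj p ^^ l) (p ! i) (p ! j)" "j < length p"
  shows "nat \<bar>int i - int j\<bar> \<le> l"
  using assms(2-)
proof (induction l arbitrary: i)
  case 0
  then show ?case using assms(1) by (simp add: nth_eq_iff_index_eq)
next
  case (Suc l)
  then obtain w where w: "path_adj p (p ! i) w" "(path_adj p ^^ l) w (p ! j)"
    by (meson relpowp_Suc_D2)
  then obtain i' where i': "i' < length p" "w = p ! i'" "i' = Suc i \<or> i = Suc i'"
    using path_adj_nth[OF assms(1)] Suc.prems by blast
  with Suc.IH[of i'] w Suc.prems show ?case by auto
qed

lemma path_walk_exists:
  assumes "distinct p" "i \<le> j" "j < length p"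
  shows "(path_adj p ^^ (j - i)) (p ! i) (p ! j)" "(path_adj p ^^ (j - i)) (p ! j) (p ! i)"
proof -
  have "(path_adj p ^^ d) (p ! i) (p ! (i + d)) \<and> (path_adj p ^^ d) (p ! (i + d)) (p ! i)"
    if "i + d < length p" for d
    using that
  proof (induction d)
    case (Suc d)
    have "path_adj p (p ! (i + d)) (p ! (i + Suc d))" "path_adj p (p ! (i + Suc d)) (p ! (i + d))"
      using Suc.prems by (auto simp: path_adj_def insert_commute)
    moreover have "(path_adj p ^^ d) (p ! i) (p ! (i + d))" "(path_adj p ^^ d) (p ! (i + d)) (p ! i)"
      using Suc by auto
    ultimately show ?case by (metis relpowp_Suc_I relpowp_Suc_I2)
  qed simp
  from this[of "j - i"] assms
  show "(path_adj p ^^ (j - i)) (p ! i) (p ! j)" "(path_adj p ^^ (j - i)) (p ! j) (p ! i)" by auto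
qed

lemma path_dist_nth:
  assumes "distinct p" "i < length p" "j < length p"
  shows "path_dist p (p ! i) (p ! j) = nat \<bar>int i - int j\<bar>"
  unfolding path_dist_def
proof (rule Least_equality)
  show "(path_adj p ^^ nat \<bar>int i - int j\<bar>) (p ! i) (p ! j)"
  proof (cases "i \<le> j")
    case True
    then have "nat \<bar>int i - int j\<bar> = j - i" by auto
    then show ?thesis using path_walk_exists(1)[OF assms(1) True assms(3)] by (simp only:)
  next
    case False
    then have "nat \<bar>int i - int j\<bar> = i - j" by auto
    moreover have "(path_adj p ^^ (i - j)) (p ! i) (p ! j)"
      using path_walk_exists(2)[of p j i] assms False by simp
    ultimately show ?thesis by (simp only:)
  qed
qed (use path_walk_length_ge assms in blast)

lemma stable_in_path_upt:
  "stable_in_path q [1..<Suc n] F \<longleftrightarrow>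
     F \<subseteq> {1..n} \<and> (\<forall>a\<in>F. \<forall>b\<in>F. a \<noteq> b \<longrightarrow> int q \<le> \<bar>int a - int b\<bar>)"
proof -
  have "path_dist [1..<Suc n] a b = nat \<bar>int a - int b\<bar>" if "a \<in> {1..n}" "b \<in> {1..n}" for a b
  proof -
    have "a - 1 < n" "b - 1 < n" using that by auto
    then show ?thesis
      using path_dist_nth[of "[1..<Suc n]" "a - 1" "b - 1"] that
    by (simp add: nth_upt of_nat_diff del: upt_Suc)
  qed
  moreover have "set [1..<Suc n] = {1..n}" by auto
  ultimately show ?thesis
    unfolding stable_in_path_def by (auto simp: subset_iff simp del: upt_Suc) force+
qed

text \<open>A hypergraph is the pair of its vertex set and its set of hyperedges.\<close>

type_synonym 'a hypergraph = "'a set \<times> 'a set set"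

definition weak_coloring :: "'a hypergraph \<Rightarrow> nat \<Rightarrow> ('a \<Rightarrow> nat) \<Rightarrow> bool" where
  "weak_coloring H c f \<longleftrightarrow>
     f ` fst H \<subseteq> {..<c} \<and> (\<forall>e\<in>snd H. \<not> (\<exists>a. \<forall>v\<in>e. f v = a))"

definition chromatic_number :: "'a hypergraph \<Rightarrow> nat" where
  "chromatic_number H = (LEAST c. \<exists>f. weak_coloring H c f)"

definition KG_stab_vertices :: "nat \<Rightarrow> nat \<Rightarrow> nat \<Rightarrow> nat set set" where
  "KG_stab_vertices q n k = {F. F \<subseteq> {1..n} \<and> card F = k \<and> stable_in_path q [1..<Suc n] F}"

definition KG_stab :: "nat \<Rightarrow> nat \<Rightarrow> nat \<Rightarrow> nat set hypergraph" where
  "KG_stab q n k =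
     (KG_stab_vertices q n k, {e. e \<subseteq> KG_stab_vertices q n k \<and> card e = q \<and> disjoint e})"

definition path_partition :: "nat \<Rightarrow> 'a list \<Rightarrow> nat \<Rightarrow> (nat \<Rightarrow> 'a set) \<Rightarrow> bool" where
  "path_partition q p m V \<longleftrightarrow>
     distinct p \<and> (\<Union>j\<in>{1..m}. V j) = set p \<and> disjoint_family_on V {1..m} \<and>
     (\<forall>j\<in>{1..m}. q - 1 \<le> card (V j))"

definition fair_stable_sets ::
  "nat \<Rightarrow> 'a list \<Rightarrow> nat \<Rightarrow> (nat \<Rightarrow> 'a set) \<Rightarrow> (nat \<Rightarrow> 'a set) \<Rightarrow> bool" where
  "fair_stable_sets q p m V S \<longleftrightarrow>
     (\<forall>i\<in>{1..q}. stable_in_path q p (S i)) \<and>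
     disjoint_family_on S {1..q} \<and>
     (\<forall>j\<in>{1..m}. card (V j - (\<Union>i\<in>{1..q}. S i)) \<le> q - 1) \<and>
     (\<forall>i\<in>{1..q}. \<forall>j\<in>{1..m}.
        int (card (S i \<inter> V j)) \<ge> \<lfloor>(real (card (V j)) + 1) / real q\<rfloor> - 1)"

end

theory Submission
  imports Defs "HOL-Library.Multiset"
begin

text \<open>The first part is a colouring argument. Appending at most \<open>q - 1\<close> consecutive vertices of
  each class at the end of the path makes every class size of the form \<open>q * t j + q - 1\<close>. Put
  \<open>k = (\<Sum>j. t j)\<close> and colour a \<open>q\<close>-stable \<open>k\<close>-set by a class in which it has more than \<open>t j\<close>
  elements, or by an extra colour if there is none. These \<open>m + 1\<close> colours are fewer than the
  chromatic number, so some \<open>q\<close> disjoint sets share a colour, which has to be the extra one: each of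
  them meets every class \<open>j\<close> in exactly \<open>t j\<close> elements. Each loses at most one vertex of each class
  when the appended vertices are deleted.

  The second part is an induction on the exponent with the stronger claim that exactly \<open>q - 1\<close>
  vertices of each class stay uncovered. The step deletes one vertex per class so that giving
  alternating signs to the remaining vertices halves every class; a stable set of half the order
  in the subpath of one sign is stable of the full order. The deletion comes from the octahedral
  Tucker lemma applied to the labelling of signed sets by their alternation length as long as this
  is less than \<open>n - m\<close>, and by an unbalanced class otherwise. Tucker's lemma follows from Fan's
  theorem that the number of alternating maximal chains is odd.\<close>

section \<open>Alternating multisets of labels\<close>

lemma even_card_involution:
  assumes "finite A" "\<And>x. x \<in> A \<Longrightarrow> f x \<in> A" "\<And>x. x \<in> A \<Longrightarrow> f (f x) = x"
    "\<And>x. x \<in> A \<Longrightarrow> f x \<noteq> x"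
  shows "even (card A)"
  using assms
proof (induction "card A" arbitrary: A rule: less_induct)
  case less
  show ?case
  proof (cases "A = {}")
    case False
    then obtain x where x: "x \<in> A" by blast
    let ?B = "A - {x, f x}"
    have sub: "{x, f x} \<subseteq> A" and two: "card {x, f x} = 2"
      using less.prems(2,4)[OF x] x by (auto simp: card_insert_if)
    then have cA: "card A = card ?B + 2"
      using card_Diff_subset[of "{x, f x}" A] card_mono[OF less.prems(1) sub] by simp
    have "even (card ?B)"
    proof (rule less.hyps)
      show "card ?B < card A" using cA by simp
      show "f y \<in> ?B" if "y \<in> ?B" for y
      proof -
        have y: "y \<in> A" "y \<noteq> x" "y \<noteq> f x" using that by auto
        then have "f y \<noteq> x" "f y \<noteq> f x" using less.prems(3)[of y] less.prems(3)[OF x] by auto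
        then show ?thesis using less.prems(2) y by simp
      qed
    qed (use less.prems in auto)
    then show ?thesis using cA by simp
  qed simp
qed

fun alternates :: "bool \<Rightarrow> bool list \<Rightarrow> bool" where
  "alternates p [] \<longleftrightarrow> True"
| "alternates p (b # bs) \<longleftrightarrow> b = p \<and> alternates (\<not> p) bs"

lemma alternates_map_Not: "alternates p (map Not bs) \<longleftrightarrow> alternates (\<not> p) bs"
  by (induction bs arbitrary: p) auto

lemma not_alternates_both: "bs \<noteq> [] \<Longrightarrow> \<not> (alternates p bs \<and> alternates (\<not> p) bs)"
  by (cases bs) auto

text \<open>An alternating word has exactly one deletion that leaves an alternating word with first
  sign \<open>p\<close>: its last entry if it begins with \<open>p\<close>, its first entry
  otherwise. Any other word has none or two, the two being the members of its only pair of equal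
  neighbours.\<close>

lemma odd_deletions_alternating:
  assumes "bs \<noteq> []"
  shows "odd (\<Sum>i<length bs. of_bool (alternates p (take i bs @ drop (Suc i) bs)) :: nat)
    \<longleftrightarrow> alternates p bs \<or> alternates (\<not> p) bs"
  using assms
proof (induction bs arbitrary: p)
  case (Cons b bs)
  show ?case
  proof (cases "bs = []")
    case False
    \<comment> \<open>Deleting the head leaves \<open>bs\<close>. Every other deletion keeps the
      head, so it needs \<open>b = p\<close> and a deletion in \<open>bs\<close> that leaves first
      sign \<open>\<not> p\<close>.\<close>
    have "(\<Sum>i<length (b # bs). of_bool (alternates p (take i (b # bs) @ drop (Suc i) (b # bs))) :: nat)
      = of_bool (alternates p bs) + (if b = p then
         (\<Sum>i<length bs. of_bool (alternates (\<not> p) (take i bs @ drop (Suc i) bs))) else 0)"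
      by (simp del: sum.lessThan_Suc add: sum.lessThan_Suc_shift)
    moreover have "\<not> (alternates p bs \<and> alternates (\<not> p) bs)"
      by (rule not_alternates_both[OF False])
    ultimately show ?thesis using Cons.IH[OF False, of "\<not> p"] by auto
  qed auto
qed simp

section \<open>Signed labels and alternation of label multisets\<close>

text \<open>A label is encoded as a natural number: \<open>+j\<close> as \<open>2 * j\<close> and \<open>-j\<close> as \<open>2 * j + 1\<close>.\<close>

definition opposite :: "nat \<Rightarrow> nat" where
  "opposite c = (if even c then Suc c else c - 1)"

text \<open>Codes sort labels by absolute value, \<open>+j\<close> before \<open>-j\<close>, so this
  is Fan's condition: the signs alternate along increasing absolute values, beginning with a
  positive one if \<open>p\<close> holds. Multisets are used since labels of a simplex may
  repeat.\<close>

definition alternating_mset :: "bool \<Rightarrow> nat multiset \<Rightarrow> bool" where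
  "alternating_mset p M \<longleftrightarrow> alternates p (map even (sorted_list_of_multiset M))"

lemma opposite_opposite [simp]: "opposite (opposite c) = c"
  by (auto simp: opposite_def elim!: oddE)

lemma even_opposite [simp]: "even (opposite c) \<longleftrightarrow> odd c"
  by (auto simp: opposite_def)

text \<open>\<open>opposite\<close> only swaps \<open>2 * j\<close> with \<open>2 * j + 1\<close>,
  so it can reverse the order only inside such a pair.\<close>

lemma opposite_mono: "a \<le> b \<Longrightarrow> b \<noteq> opposite a \<Longrightarrow> opposite a \<le> opposite b"
  by (auto simp: opposite_def elim!: oddE evenE)

lemma same_half_imp_opposite: "a div 2 = b div 2 \<Longrightarrow> a \<noteq> b \<Longrightarrow> b = opposite a"
  unfolding opposite_def by (cases "even a"; cases "even b") (auto elim!: oddE evenE)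

lemma sorted_list_of_multiset_eq: "sorted xs \<Longrightarrow> mset xs = M \<Longrightarrow> sorted_list_of_multiset M = xs"
  by (metis sorted_list_of_multiset_mset sorted_sort_id)

text \<open>Without complementary labels the sorted order survives negation, and every sign
  flips.\<close>

lemma alternating_mset_opposite:
  assumes "\<And>a b. a \<in># M \<Longrightarrow> b \<in># M \<Longrightarrow> b \<noteq> opposite a"
  shows "alternating_mset p (image_mset opposite M) \<longleftrightarrow> alternating_mset (\<not> p) M"
proof -
  let ?ws = "sorted_list_of_multiset M"
  have set: "set ?ws = set_mset M" by simp
  have "sorted (map opposite ?ws)"
    unfolding sorted_map
    by (rule sorted_wrt_mono_rel[of _ "(\<le>)"]) (use assms set opposite_mono in auto)
  then have "sorted_list_of_multiset (image_mset opposite M) = map opposite ?ws"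
    by (rule sorted_list_of_multiset_eq) (simp add: mset_map)
  then show ?thesis
    unfolding alternating_mset_def
    using alternates_map_Not[of p "map even ?ws"] by (simp add: comp_def)
qed

text \<open>The parity count for the facets of a simplex with vertex indices \<open>I\<close>.
  Deletions are counted by index, so equal labels at different vertices count separately.\<close>

lemma odd_deletions_alternating_mset:
  assumes "finite I" "I \<noteq> {}" and M: "M = image_mset g (mset_set I)"
  shows "odd (card {i \<in> I. alternating_mset p (M - {#g i#})})
    \<longleftrightarrow> alternating_mset p M \<or> alternating_mset (\<not> p) M"
proof -
  let ?ws = "sorted_list_of_multiset M"
  have ws: "mset ?ws = M" by simp
  have "card {i \<in> I. alternating_mset p (M - {#g i#})} =
      (\<Sum>i\<in>I. of_bool (alternating_mset p (M - {#g i#})))"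
    using assms(1) by (simp add: sum.If_cases of_bool_def Int_def)
  also have "\<dots> = (\<Sum>v\<in>#M. of_bool (alternating_mset p (M - {#v#})))"
    unfolding M by (simp add: sum_unfold_sum_mset image_mset.compositionality comp_def)
  also have "\<dots> = sum_list (map (\<lambda>v. of_bool (alternating_mset p (M - {#v#}))) ?ws)"
    by (metis mset_map sum_mset_sum_list ws)
  also have "\<dots> = (\<Sum>i<length ?ws. of_bool (alternating_mset p (M - {#?ws ! i#})))"
    by (simp add: sum_list_sum_nth atLeast0LessThan)
  also have "\<dots> = (\<Sum>i<length (map even ?ws).
      of_bool (alternates p (take i (map even ?ws) @ drop (Suc i) (map even ?ws))))"
  proof (rule sum.cong)
    fix i assume "i \<in> {..<length (map even ?ws)}"
    then have i: "i < length ?ws" by simp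
    have "?ws = take i ?ws @ ?ws ! i # drop (Suc i) ?ws"
      using i by (rule id_take_nth_drop)
    then have 1: "M = mset (take i ?ws @ ?ws ! i # drop (Suc i) ?ws)" and
      2: "sorted (take i ?ws @ ?ws ! i # drop (Suc i) ?ws)"
      by (metis ws, metis sorted_sorted_list_of_multiset)
    from 1 have "M = add_mset (?ws ! i) (mset (take i ?ws @ drop (Suc i) ?ws))" by simp
    then have "mset (take i ?ws @ drop (Suc i) ?ws) = M - {#?ws ! i#}"
      by (metis add_mset_remove_trivial)
    moreover have "sorted (take i ?ws @ drop (Suc i) ?ws)"
      using 2 by (auto simp: sorted_append)
    ultimately have "sorted_list_of_multiset (M - {#?ws ! i#}) = take i ?ws @ drop (Suc i) ?ws"
      by (intro sorted_list_of_multiset_eq)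
    then show "of_bool (alternating_mset p (M - {#?ws ! i#})) =
      (of_bool (alternates p (take i (map even ?ws) @ drop (Suc i) (map even ?ws))) :: nat)"
      by (simp add: alternating_mset_def take_map drop_map)
  qed simp
  finally have eq: "card {i \<in> I. alternating_mset p (M - {#g i#})} =
    (\<Sum>i<length (map even ?ws).
      of_bool (alternates p (take i (map even ?ws) @ drop (Suc i) (map even ?ws))))" .
  have "M \<noteq> {#}" using assms by (simp add: mset_set_empty_iff)
  then have "map even ?ws \<noteq> []" using ws by (metis map_is_Nil_conv mset.simps(1))
  then show ?thesis
    unfolding eq unfolding alternating_mset_def by (rule odd_deletions_alternating)
qed

text \<open>Equal labels would be neighbours in the sorted list and have equal parity.\<close>

lemma alternates_sorted_distinct:
  "sorted xs \<Longrightarrow> alternates p (map even xs) \<Longrightarrow> distinct (xs :: nat list)"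
proof (induction xs arbitrary: p)
  case (Cons x xs)
  then have d: "distinct xs" by auto
  show ?case
  proof (cases xs)
    case (Cons y ys)
    then have "x \<noteq> y" "x \<le> y" using Cons.prems by auto
    then have "x < y" by simp
    then show ?thesis using d Cons Cons.prems by auto
  qed simp
qed simp

section \<open>Fan's theorem and the octahedral Tucker lemma\<close>

text \<open>A signed set: each element carries at most one sign. The nonempty ones over
  \<open>A\<close> are the proper faces of the cross-polytope, hence the vertices of its subdivided
  boundary.\<close>

definition consistent :: "('a \<times> bool) set \<Rightarrow> bool" where
  "consistent x \<longleftrightarrow> inj_on fst x"

definition negate :: "'a \<times> bool \<Rightarrow> 'a \<times> bool" where
  "negate = map_prod id Not"

definition antipodal_labelling :: "'a set \<Rightarrow> (('a \<times> bool) set \<Rightarrow> nat) \<Rightarrow> bool" where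
  "antipodal_labelling A l \<longleftrightarrow>
     (\<forall>x. consistent x \<longrightarrow> x \<noteq> {} \<longrightarrow> fst ` x \<subseteq> A \<longrightarrow> l (negate ` x) = opposite (l x))"

text \<open>Vertices of the barycentric subdivision are adjacent when one signed set contains the
  other, so this forbids edges labelled \<open>+j\<close>, \<open>-j\<close>.\<close>

definition complementary_free :: "'a set \<Rightarrow> (('a \<times> bool) set \<Rightarrow> nat) \<Rightarrow> bool" where
  "complementary_free A l \<longleftrightarrow>
     (\<forall>x y. consistent y \<longrightarrow> x \<noteq> {} \<longrightarrow> x \<subseteq> y \<longrightarrow> fst ` y \<subseteq> A \<longrightarrow> l y \<noteq> opposite (l x))"

text \<open>A signed word lists the vertices of a maximal simplex of the barycentric subdivision of
  the boundary of the cross-polytope: its nonempty prefixes form a maximal chain of signed sets.\<close>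

definition signed_words :: "'a set \<Rightarrow> ('a \<times> bool) list set" where
  "signed_words A = {w. distinct (map fst w) \<and> fst ` set w = A}"

definition prefix_labels :: "(('a \<times> bool) set \<Rightarrow> nat) \<Rightarrow> ('a \<times> bool) list \<Rightarrow> nat multiset" where
  "prefix_labels l w = image_mset (\<lambda>i. l (set (take (Suc i) w))) (mset_set {..<length w})"

lemma negate_simps [simp]:
  "negate (a, b) = (a, \<not> b)" "fst (negate z) = fst z" "negate (negate z) = z" "negate z \<noteq> z"
  by (cases z; auto simp: negate_def)+

lemma mem_negate_image: "(a, b) \<in> negate ` x \<longleftrightarrow> (a, \<not> b) \<in> x"
proof
  assume "(a, b) \<in> negate ` x"
  then obtain z where "z \<in> x" "(a, b) = negate z" by auto
  then show "(a, \<not> b) \<in> x" by (metis negate_simps(1,3))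
next
  assume "(a, \<not> b) \<in> x"
  then have "negate (a, \<not> b) \<in> negate ` x" by (rule imageI)
  then show "(a, b) \<in> negate ` x" by simp
qed

lemma consistentD: "consistent x \<Longrightarrow> (a, b) \<in> x \<Longrightarrow> (a, c) \<in> x \<Longrightarrow> b = c"
  by (force simp: consistent_def inj_on_def)

lemma consistent_subset: "consistent y \<Longrightarrow> x \<subseteq> y \<Longrightarrow> consistent x"
  by (auto simp: consistent_def intro: inj_on_subset)

lemma signed_words_length: "w \<in> signed_words A \<Longrightarrow> length w = card A"
  by (auto simp: signed_words_def dest: distinct_card)

lemma finite_signed_words:
  assumes "finite A" shows "finite (signed_words A)"
proof (rule finite_subset)
  show "signed_words A \<subseteq> {w. set w \<subseteq> A \<times> UNIV \<and> length w = card A}"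
    by (auto simp: signed_words_length) (force simp: signed_words_def)
  show "finite {w. set w \<subseteq> A \<times> (UNIV :: bool set) \<and> length w = card A}"
    using assms by (intro finite_lists_length_eq) auto
qed

lemma consistent_set_word: "distinct (map fst w) \<Longrightarrow> consistent (set w)"
  by (simp add: consistent_def distinct_map)

lemma prefix_labels_elem:
  assumes "c \<in># prefix_labels l w"
  obtains i where "i < length w" "c = l (set (take (Suc i) w))"
  using assms by (auto simp: prefix_labels_def)

text \<open>Any two prefixes are comparable, and being opposite is symmetric.\<close>

lemma prefix_labels_complementary_free:
  assumes "complementary_free A l" "w \<in> signed_words A"
    "c \<in># prefix_labels l w" "d \<in># prefix_labels l w"
  shows "d \<noteq> opposite c"
proof -
  obtain i j where i: "i < length w" "c = l (set (take (Suc i) w))"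
    and j: "j < length w" "d = l (set (take (Suc j) w))"
    using assms(3,4) by (elim prefix_labels_elem)
  have w: "consistent (set w)" "fst ` set w = A"
    using assms(2) by (auto simp: signed_words_def consistent_set_word)
  have ne: "set (take (Suc k) w) \<noteq> {}" if "k < length w" for k
    using that by (cases w) auto
  have cons: "consistent (set (take k w))" "fst ` set (take k w) \<subseteq> A" for k
    using w consistent_subset[OF w(1)] set_take_subset[of k w] by blast+
  consider "set (take (Suc i) w) \<subseteq> set (take (Suc j) w)" | "set (take (Suc j) w) \<subseteq> set (take (Suc i) w)"
    using set_take_subset_set_take nat_le_linear by metis
  then have "d \<noteq> opposite c \<or> c \<noteq> opposite d"
    using assms(1) cons ne[OF i(1)] ne[OF j(1)] unfolding complementary_free_def i(2) j(2)
    by cases meson+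
  then show ?thesis by (metis opposite_opposite)
qed

lemma prefix_labels_negate:
  assumes "antipodal_labelling A l" "w \<in> signed_words A"
  shows "prefix_labels l (map negate w) = image_mset opposite (prefix_labels l w)"
proof -
  have "l (set (take (Suc i) (map negate w))) = opposite (l (set (take (Suc i) w)))"
    if "i < length w" for i
  proof -
    have "consistent (set (take (Suc i) w))" "fst ` set (take (Suc i) w) \<subseteq> A"
      using assms(2) consistent_subset[OF consistent_set_word[of w] set_take_subset]
        set_take_subset[of "Suc i" w]
      by (auto simp: signed_words_def)
    moreover have "set (take (Suc i) w) \<noteq> {}" using that by (cases w) auto
    ultimately have "l (negate ` set (take (Suc i) w)) = opposite (l (set (take (Suc i) w)))"
      using assms(1) by (auto simp: antipodal_labelling_def)
    then show ?thesis by (simp add: take_map)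
  qed
  then show ?thesis
    unfolding prefix_labels_def
    by (auto simp: image_mset.compositionality comp_def intro!: image_mset_cong)
qed

lemma negate_signed_words: "w \<in> signed_words A \<Longrightarrow> map negate w \<in> signed_words A"
  by (auto simp: signed_words_def image_image comp_def)

section \<open>Facets missing the \<open>i\<close>-th vertex, and adjacent maximal simplices\<close>

definition facet_labels ::
  "(('a \<times> bool) set \<Rightarrow> nat) \<Rightarrow> ('a \<times> bool) list \<Rightarrow> nat \<Rightarrow> nat multiset" where
  "facet_labels l w i = image_mset (\<lambda>j. l (set (take (Suc j) w))) (mset_set ({..<length w} - {i}))"

lemma facet_labels_eq:
  "i < length w \<Longrightarrow> facet_labels l w i = prefix_labels l w - {#l (set (take (Suc i) w))#}"
  by (simp add: facet_labels_def prefix_labels_def mset_set_Diff image_mset_Diff)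

text \<open>The maximal simplex sharing with \<open>w\<close> all vertices except the \<open>i\<close>-th one.\<close>

definition neighbour :: "('a \<times> bool) list \<Rightarrow> nat \<Rightarrow> ('a \<times> bool) list" where
  "neighbour w i = (if Suc i < length w then w[i := w ! Suc i, Suc i := w ! i]
     else w[i := negate (w ! i)])"

lemma length_neighbour [simp]: "length (neighbour w i) = length w"
  by (simp add: neighbour_def)

lemma neighbour_neighbour: "i < length w \<Longrightarrow> neighbour (neighbour w i) i = w"
  by (rule nth_equalityI) (auto simp: neighbour_def nth_list_update)

lemma neighbour_neq:
  assumes "distinct (map fst w)" "i < length w"
  shows "neighbour w i \<noteq> w"
proof (cases "Suc i < length w")
  case True
  then have "fst (w ! i) \<noteq> fst (w ! Suc i)"
    using assms by (auto simp: distinct_conv_nth)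
  moreover have "neighbour w i ! i = w ! Suc i" using True by (simp add: neighbour_def)
  ultimately show ?thesis by auto
next
  case False
  then have "neighbour w i ! i = negate (w ! i)" using assms by (simp add: neighbour_def)
  then show ?thesis by (metis negate_simps(4))
qed

lemma map_fst_neighbour:
  assumes "distinct (map fst w)" "i < length w"
  shows "distinct (map fst (neighbour w i)) \<and> fst ` set (neighbour w i) = fst ` set w"
proof (cases "Suc i < length w")
  case True
  have "map fst (neighbour w i) = (map fst w)[i := map fst w ! Suc i, Suc i := map fst w ! i]"
    using True by (simp add: neighbour_def map_update)
  then show ?thesis using assms True
    by (metis Suc_lessD distinct_swap length_map list.set_map set_swap)
next
  case False
  have "map fst (neighbour w i) = map fst w"
    using assms False by (auto simp: neighbour_def map_update intro!: nth_equalityI simp: nth_list_update)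
  then show ?thesis using assms by (metis list.set_map)
qed

lemma neighbour_signed_words:
  "w \<in> signed_words A \<Longrightarrow> i < length w \<Longrightarrow> neighbour w i \<in> signed_words A"
  using map_fst_neighbour[of w i] by (simp add: signed_words_def)

text \<open>For \<open>j < i\<close> the prefix ends before the changed entries; for
  \<open>j > i\<close> it contains both swapped entries.\<close>

lemma set_take_neighbour:
  assumes "i < length w" "j < length w" "j \<noteq> i"
  shows "set (take (Suc j) (neighbour w i)) = set (take (Suc j) w)"
proof (cases "j < i")
  case True
  then show ?thesis by (simp add: neighbour_def)
next
  case False
  then have j: "i < j" "Suc i < length w" using assms by auto
  have "take (Suc j) (neighbour w i) =
     (take (Suc j) w)[i := take (Suc j) w ! Suc i, Suc i := take (Suc j) w ! i]"
    using j by (simp add: neighbour_def take_update_swap)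
  then show ?thesis using j assms by (metis Suc_leI Suc_less_eq length_take less_Suc_eq min_less_iff_conj set_swap)
qed

lemma facet_labels_neighbour:
  "i < length w \<Longrightarrow> facet_labels l (neighbour w i) i = facet_labels l w i"
  unfolding facet_labels_def by (auto simp: set_take_neighbour intro!: image_mset_cong)

text \<open>Fan's theorem by double counting the alternating facets of the simplices in the
  hemisphere where \<open>a\<close> is positive. Counted by simplex, their parity is that of the
  alternating simplices of the whole sphere; counted by facet, it is that of the alternating
  simplices on the equator, the sphere over \<open>A\<close>.\<close>

theorem odd_alternating_chains:
  assumes "finite A" "antipodal_labelling A l" "complementary_free A l"
  shows "odd (card {w \<in> signed_words A. alternating_mset True (prefix_labels l w)})"
  using assms
proof (induction A)
  case empty
  have "{w \<in> signed_words {}. alternating_mset True (prefix_labels l w)} = {[]}"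
    by (auto simp: signed_words_def prefix_labels_def alternating_mset_def)
  then show ?case by simp
next
  case (insert a A)
  let ?W = "signed_words (insert a A)"
  let ?H = "{w \<in> ?W. (a, True) \<in> set w}"
  let ?n = "card A"
  let ?alt = "\<lambda>p w. alternating_mset p (prefix_labels l w)"
  have IH: "odd (card {w \<in> signed_words A. ?alt True w})"
    using insert.prems by (intro insert.IH) (auto simp: antipodal_labelling_def complementary_free_def
        subset_insertI2)
  have finW: "finite ?W" using insert.hyps by (simp add: finite_signed_words)
  then have finH: "finite ?H" by simp
  have len: "length w = Suc ?n" if "w \<in> ?W" for w
    using signed_words_length[OF that] insert.hyps by simp
  \<comment> \<open>\<open>R w\<close> collects the facets of \<open>w\<close> alternating from a
    positive label, \<open>E\<close> all such incidences in the hemisphere, and \<open>B\<close>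
    those on the equator, where dropping the last prefix removes the entry
    \<open>(a, True)\<close>.\<close>
  define R where "R w = {i. i < Suc ?n \<and> alternating_mset True (facet_labels l w i)}" for w
  define E where "E = Sigma ?H R"
  define B where "B = {(w, i) \<in> E. i = ?n \<and> w ! ?n = (a, True)}"
  have finE: "finite E" unfolding E_def R_def using finH by auto

  have R: "odd (card (R w)) \<longleftrightarrow> ?alt True w \<or> ?alt False w" if "w \<in> ?H" for w
  proof -
    have "R w = {i \<in> {..<length w}. alternating_mset True
        (prefix_labels l w - {#l (set (take (Suc i) w))#})}"
      using that len by (auto simp: R_def facet_labels_eq)
    then show ?thesis
      using odd_deletions_alternating_mset[of "{..<length w}" "prefix_labels l w"
          "\<lambda>i. l (set (take (Suc i) w))" True] that len[of w]
      by (cases "w = []") (simp_all add: lessThan_empty_iff prefix_labels_def[symmetric])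
  qed
  have notboth: "\<not> (?alt True w \<and> ?alt False w)" if "w \<in> ?W" for w
  proof -
    have "prefix_labels l w \<noteq> {#}" using len[OF that] by (simp add: prefix_labels_def mset_set_empty_iff lessThan_empty_iff)
    then have "map even (sorted_list_of_multiset (prefix_labels l w)) \<noteq> []"
      by (metis map_is_Nil_conv mset.simps(1) mset_sorted_list_of_multiset)
    from not_alternates_both[OF this, of True] show ?thesis by (simp add: alternating_mset_def)
  qed
  have "card E = (\<Sum>w\<in>?H. card (R w))"
    unfolding E_def using finH by (intro card_SigmaI) (auto simp: R_def)
  then have "odd (card E) \<longleftrightarrow> odd (card {w \<in> ?H. odd (card (R w))})"
    using finH by (simp add: even_sum_iff)
  also have "{w \<in> ?H. odd (card (R w))} = {w \<in> ?H. ?alt True w} \<union> {w \<in> ?H. ?alt False w}"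
    using R by auto
  also have "card \<dots> = card {w \<in> ?H. ?alt True w} + card {w \<in> ?H. ?alt False w}"
    using finW notboth by (intro card_Un_disjoint) auto
  finally have E1: "odd (card E) \<longleftrightarrow>
     odd (card {w \<in> ?H. ?alt True w} + card {w \<in> ?H. ?alt False w})" .

  \<comment> \<open>The antipodal map exchanges the hemispheres and the two kinds of
    alternation.\<close>
  have "card {w \<in> ?H. ?alt False w} = card {w \<in> ?W - ?H. ?alt True w}"
  proof (rule bij_betw_same_card)
    have alt: "?alt p (map negate w) \<longleftrightarrow> ?alt (\<not> p) w" if "w \<in> ?W" for w p
      using alternating_mset_opposite[of "prefix_labels l w"] prefix_labels_negate[OF insert.prems(1) that]
        prefix_labels_complementary_free[OF insert.prems(2) that] by metis
    have mem: "(a, True) \<in> set (map negate w) \<longleftrightarrow> (a, True) \<notin> set w" if "w \<in> ?W" for w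
    proof -
      have "consistent (set w)" "a \<in> fst ` set w"
        using that by (auto simp: signed_words_def consistent_set_word)
      then obtain b where b: "(a, b) \<in> set w" by force
      have "(a, \<not> b) \<notin> set w"
        using consistentD[OF \<open>consistent (set w)\<close> b] by blast
      then show ?thesis using b by (cases b) (simp_all add: mem_negate_image)
    qed
    show "bij_betw (map negate) {w \<in> ?H. ?alt False w} {w \<in> ?W - ?H. ?alt True w}"
    proof (rule bij_betw_byWitness[where f' = "map negate"])
      show "map negate ` {w \<in> ?H. ?alt False w} \<subseteq> {w \<in> ?W - ?H. ?alt True w}"
        using alt mem negate_signed_words by auto
      show "map negate ` {w \<in> ?W - ?H. ?alt True w} \<subseteq> {w \<in> ?H. ?alt False w}"
        using alt mem negate_signed_words by auto
    qed (auto simp: comp_def)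
  qed
  moreover have "card {w \<in> ?W. ?alt True w} = card {w \<in> ?H. ?alt True w} + card {w \<in> ?W - ?H. ?alt True w}"
    using finW by (subst card_Un_disjoint[symmetric]) (auto intro!: arg_cong[where f = card])
  ultimately have E2: "odd (card {w \<in> ?W. ?alt True w}) \<longleftrightarrow> odd (card E)"
    using E1 by simp

  \<comment> \<open>Off the equator a facet lies in exactly two simplices of the hemisphere,
    exchanged by \<open>neighbour\<close>.\<close>
  have "even (card (E - B))"
  proof (rule even_card_involution[where f = "\<lambda>(w, i). (neighbour w i, i)"])
    show "finite (E - B)" using finE by simp
    fix z assume z: "z \<in> E - B"
    obtain w i where wi: "z = (w, i)" by force
    have w: "w \<in> ?W" "(a, True) \<in> set w" "i < length w" "i < Suc ?n"
      "alternating_mset True (facet_labels l w i)"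
      using z wi len by (auto simp: E_def R_def)
    then have dist: "distinct (map fst w)" by (simp add: signed_words_def)
    have lw: "length w = Suc ?n" using len w by simp
    obtain k where k: "k < length w" "w ! k = (a, True)" using w(2) by (auto simp: in_set_conv_nth)
    have neq: "i = ?n \<Longrightarrow> w ! i \<noteq> (a, True)" using z wi by (auto simp: B_def)
    \<comment> \<open>A swap keeps all entries, and the sign change of the last entry spares
      \<open>(a, True)\<close>, which is not last outside \<open>B\<close>.\<close>
    have "(a, True) \<in> set (neighbour w i)"
    proof (cases "Suc i < length w")
      case True
      then show ?thesis using w(2) by (simp add: neighbour_def)
    next
      case False
      then have "i = ?n" using w(3) lw by simp
      then have "k \<noteq> i" using neq k by auto
      then have "neighbour w i ! k = (a, True)" using False k by (simp add: neighbour_def)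
      then show ?thesis using k by (metis length_neighbour nth_mem)
    qed
    then have inE: "(neighbour w i, i) \<in> E"
      using neighbour_signed_words[OF w(1,3)] w by (simp add: E_def R_def facet_labels_neighbour)
    \<comment> \<open>Otherwise \<open>w ! i\<close> would also have first component
      \<open>a\<close>, so it would be the entry \<open>(a, True)\<close> itself, which
      \<open>neq\<close> excludes.\<close>
    have "neighbour w i ! i \<noteq> (a, True)" if "i = ?n"
    proof
      assume "neighbour w i ! i = (a, True)"
      then have "fst (w ! i) = a" using that lw
        by (simp add: neighbour_def) (metis fst_conv negate_simps(2))
      then have "fst (w ! i) = fst (w ! k)" using k by simp
      then have "i = k" using dist k(1) w(3) by (simp add: distinct_conv_nth) metis
      then show False using neq[OF that] k by simp
    qed
    then have "(neighbour w i, i) \<notin> B" by (auto simp: B_def)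
    then show "(case z of (w, i) \<Rightarrow> (neighbour w i, i)) \<in> E - B" using inE wi by simp
    show "(case case z of (w, i) \<Rightarrow> (neighbour w i, i) of (w, i) \<Rightarrow> (neighbour w i, i)) = z"
      using wi w by (simp add: neighbour_neighbour)
    show "(case z of (w, i) \<Rightarrow> (neighbour w i, i)) \<noteq> z"
      using wi neighbour_neq[OF dist w(3)] by simp
  qed
  moreover have "card E = card (E - B) + card B"
  proof -
    have "B \<subseteq> E" by (auto simp: B_def)
    then show ?thesis using finE by (simp add: card_Diff_subset card_mono finite_subset)
  qed
  ultimately have E3: "odd (card E) \<longleftrightarrow> odd (card B)" by simp

  \<comment> \<open>Equatorial facets are the maximal simplices over \<open>A\<close>, obtained by
    removing the final \<open>(a, True)\<close>.\<close>
  have "card {w \<in> signed_words A. ?alt True w} = card B"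
  proof (rule bij_betw_same_card)
    have facet: "facet_labels l (u @ [(a, True)]) ?n = prefix_labels l u" if "length u = ?n" for u
    proof -
      have eq: "{..<length (u @ [(a, True)])} - {?n} = {..<?n}" using that by auto
      show ?thesis
        unfolding facet_labels_def prefix_labels_def eq that
        by (rule image_mset_cong) (use that in simp)
    qed
    have ext: "u @ [(a, True)] \<in> ?W \<longleftrightarrow> u \<in> signed_words A" for u
      using insert.hyps(2) by (auto simp: signed_words_def)
    show "bij_betw (\<lambda>u. (u @ [(a, True)], ?n)) {w \<in> signed_words A. ?alt True w} B"
    proof (rule bij_betw_byWitness[where f' = "\<lambda>(w, i). butlast w"])
      show "(\<lambda>u. (u @ [(a, True)], ?n)) ` {w \<in> signed_words A. ?alt True w} \<subseteq> B"
        using facet ext signed_words_length by (force simp: B_def E_def R_def nth_append)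
      have dec: "\<exists>u. z = (u @ [(a, True)], ?n) \<and> u \<in> signed_words A \<and> ?alt True u" if z: "z \<in> B" for z
      proof -
        obtain w where w: "z = (w, ?n)" "w \<in> ?W" "w ! ?n = (a, True)"
          "alternating_mset True (facet_labels l w ?n)"
          using z by (auto simp: B_def E_def R_def)
        have lw: "length w = Suc ?n" using len w by simp
        then have "w = butlast w @ [(a, True)]"
          using w(3) by (metis append_butlast_last_id diff_Suc_1 last_conv_nth length_0_conv nat.distinct(1))
        then obtain u where u: "w = u @ [(a, True)]" by blast
        then have uA: "u \<in> signed_words A" using w ext by simp
        then have "facet_labels l w ?n = prefix_labels l u"
          using facet signed_words_length u by blast
        then show ?thesis using uA u w by auto
      qed
      show "(\<lambda>(w, i). butlast w) ` B \<subseteq> {w \<in> signed_words A. ?alt True w}"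
        using dec by fastforce
      show "\<forall>z\<in>B. (\<lambda>u. (u @ [(a, True)], ?n)) ((\<lambda>(w, i). butlast w) z) = z"
        using dec by fastforce
    qed simp
  qed
  then show ?case using IH E2 E3 by simp
qed

text \<open>An alternating chain carries \<open>card A\<close> labels. Alternation makes them
  distinct, and without complementary pairs their absolute values are distinct too; but codes below
  \<open>2 * s\<close> offer only \<open>s\<close> absolute values.\<close>

theorem octahedral_Tucker:
  assumes "finite A" "antipodal_labelling A l"
    and bound: "\<And>x. consistent x \<Longrightarrow> x \<noteq> {} \<Longrightarrow> fst ` x \<subseteq> A \<Longrightarrow> l x < 2 * s"
    and "s < card A"
  shows "\<not> complementary_free A l"
proof
  assume cf: "complementary_free A l"
  have "{w \<in> signed_words A. alternating_mset True (prefix_labels l w)} \<noteq> {}"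
    using odd_alternating_chains[OF assms(1,2) cf] by (metis card.empty even_zero)
  then obtain w where w: "w \<in> signed_words A" "alternating_mset True (prefix_labels l w)" by blast
  let ?xs = "sorted_list_of_multiset (prefix_labels l w)"
  have "distinct ?xs"
    using w(2) alternates_sorted_distinct[of ?xs True]
    by (simp add: alternating_mset_def)
  moreover have "inj_on (\<lambda>c. c div 2) (set ?xs)"
    using prefix_labels_complementary_free[OF cf w(1)] same_half_imp_opposite
    by (auto simp: inj_on_def)
  ultimately have "card ((\<lambda>c. c div 2) ` set ?xs) = length ?xs"
    by (simp add: card_image distinct_card del: set_sorted_list_of_multiset)
  also have "length ?xs = card A"
    using signed_words_length[OF w(1)]
    by (metis card_lessThan finite_lessThan mset_sorted_list_of_multiset prefix_labels_def size_image_mset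
        size_mset size_mset_set)
  finally have card: "card ((\<lambda>c. c div 2) ` set ?xs) = card A" .
  have "(\<lambda>c. c div 2) ` set ?xs \<subseteq> {..<s}"
  proof
    fix y assume "y \<in> (\<lambda>c. c div 2) ` set ?xs"
    then obtain c where c: "c \<in># prefix_labels l w" "y = c div 2" by auto
    then obtain i where i: "i < length w" "c = l (set (take (Suc i) w))"
      by (elim prefix_labels_elem)
    have "consistent (set (take (Suc i) w))" "fst ` set (take (Suc i) w) \<subseteq> A"
      using w(1) consistent_subset[OF consistent_set_word[of w] set_take_subset]
        set_take_subset[of "Suc i" w]
      by (auto simp: signed_words_def)
    moreover have "set (take (Suc i) w) \<noteq> {}" using i by (cases w) auto
    ultimately have "c < 2 * s" using bound i by simp
    then show "y \<in> {..<s}" using c by auto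
  qed
  then have "card A \<le> s" using card by (metis card_lessThan card_mono finite_lessThan)
  then show False using assms(4) by simp
qed

section \<open>Halving a path\<close>

text \<open>The greedy choice gives the greatest length of a subsequence of signed vertices whose
  signs alternate from \<open>b\<close>.\<close>

fun alt_length :: "('a \<times> bool) set \<Rightarrow> bool \<Rightarrow> 'a list \<Rightarrow> nat" where
  "alt_length x b [] = 0"
| "alt_length x b (a # as) =
    (if (a, b) \<in> x then Suc (alt_length x (\<not> b) as) else alt_length x b as)"

definition side :: "('a \<times> bool) set \<Rightarrow> bool \<Rightarrow> 'a set" where
  "side x b = {a. (a, b) \<in> x}"

text \<open>Dropping the first entry of an alternating subsequence flips its first sign.\<close>

lemma alt_length_le_Suc: "alt_length x b as \<le> Suc (alt_length x (\<not> b) as)"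
proof (induction as arbitrary: b)
  case (Cons a as)
  show ?case using Cons[of b] Cons[of "\<not> b"] by auto
qed simp

lemma alt_length_mono: "x \<subseteq> y \<Longrightarrow> alt_length x b as \<le> alt_length y b as"
proof (induction as arbitrary: b)
  case (Cons a as)
  \<comment> \<open>This covers the case that only \<open>y\<close> takes \<open>a\<close>: it gains
    one entry there, and the flip of the next required sign costs at most one.\<close>
  have "alt_length x b as \<le> Suc (alt_length y (\<not> b) as)"
    using alt_length_le_Suc[of x b as] Cons.IH[of "\<not> b"] Cons.prems by simp
  then show ?case using Cons by auto
qed simp

lemma alt_length_negate: "alt_length (negate ` x) b as = alt_length x (\<not> b) as"
proof (induction as arbitrary: b)
  case (Cons a as)
  then show ?case by (simp add: mem_negate_image)
qed simp

text \<open>The first signed vertex prolongs the alternation from its own sign only, so that one is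
  longer. This gives the labels in \<open>fair_halving\<close> a well-defined sign.\<close>

lemma alt_length_neq:
  "consistent x \<Longrightarrow> fst ` x \<inter> set as \<noteq> {} \<Longrightarrow> alt_length x b as \<noteq> alt_length x (\<not> b) as"
proof (induction as arbitrary: b)
  case (Cons a as)
  show ?case
  proof (cases "a \<in> fst ` x")
    case True
    then obtain c where c: "(a, c) \<in> x" by force
    then have "(a, \<not> c) \<notin> x" using consistentD[OF Cons.prems(1) c] by blast
    then show ?thesis using c by (cases "b = c") auto
  next
    case False
    then have "(a, c) \<notin> x" for c by force
    then show ?thesis using Cons False by auto
  qed
qed simp

lemma alt_length_le_count:
  "alt_length x b as \<le> length (filter (\<lambda>a. a \<in> side x True) as) + length (filter (\<lambda>a. a \<in> side x False) as)"
proof (induction as arbitrary: b)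
  case (Cons a as)
  then show ?case by (cases b) (auto simp: side_def le_SucI intro: le_trans[OF _ le_SucI])
qed simp

text \<open>In an alternating subsequence from \<open>b\<close>, half of the entries carry
  \<open>b\<close>, rounded up, and half carry \<open>\<not> b\<close>, rounded down.\<close>

lemma alt_length_le_twice:
  "alt_length x b as \<le> 2 * length (filter (\<lambda>a. a \<in> side x b) as)"
  "alt_length x b as \<le> Suc (2 * length (filter (\<lambda>a. a \<in> side x (\<not> b)) as))"
proof (induction as arbitrary: b)
  case (Cons a as)
  {
    case 1
    show ?case using Cons[of b] Cons[of "\<not> b"] by (auto simp: side_def)
  next
    case 2
    show ?case using Cons[of b] Cons[of "\<not> b"] by (auto simp: side_def)
  }
qed simp_all

text \<open>When the alternation uses every signed vertex, none may be skipped, so the head cannot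
  carry the wrong sign.\<close>

lemma alt_length_full_hd:
  assumes "alt_length x b (a # as) =
    length (filter (\<lambda>a. a \<in> side x True) (a # as)) + length (filter (\<lambda>a. a \<in> side x False) (a # as))"
  shows "(a, \<not> b) \<notin> x"
  using assms alt_length_le_count[of x b as] alt_length_le_count[of x "\<not> b" as]
  by (cases b) (auto simp: side_def split: if_splits)

text \<open>With every signed vertex used, the signs alternate along the path, so no side contains
  two neighbours. This is what later doubles the distances.\<close>

lemma alt_length_full_successively:
  "alt_length x b as =
    length (filter (\<lambda>a. a \<in> side x True) as) + length (filter (\<lambda>a. a \<in> side x False) as) \<Longrightarrow>
   successively (\<lambda>u v. \<forall>c. \<not> (u \<in> side x c \<and> v \<in> side x c)) as"
proof (induction as arbitrary: b)
  case (Cons a as)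
  let ?cnt = "\<lambda>as. length (filter (\<lambda>a. a \<in> side x True) as) + length (filter (\<lambda>a. a \<in> side x False) as)"
  have nb: "(a, \<not> b) \<notin> x" using alt_length_full_hd Cons.prems by metis
  show ?case
  proof (cases "(a, b) \<in> x")
    case True
    then have full: "alt_length x (\<not> b) as = ?cnt as"
      using Cons.prems nb by (cases b) (auto simp: side_def)
    then have succ: "successively (\<lambda>u v. \<forall>c. \<not> (u \<in> side x c \<and> v \<in> side x c)) as"
      by (rule Cons.IH)
    show ?thesis
    proof (cases as)
      case (Cons a' as')
      then have "(a', b) \<notin> x" using full alt_length_full_hd[of x "\<not> b" a' as'] by simp
      then have "\<not> (a \<in> side x c \<and> a' \<in> side x c)" for c
        using nb by (cases "c = b") (auto simp: side_def)
      then show ?thesis using succ Cons by simp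
    qed simp
  next
    case False
    then have none: "(a, c) \<notin> x" for c using nb by (cases "c = b") auto
    then have "alt_length x b as = ?cnt as" using Cons.prems by (simp add: side_def)
    then have "successively (\<lambda>u v. \<forall>c. \<not> (u \<in> side x c \<and> v \<in> side x c)) as"
      by (rule Cons.IH)
    then show ?thesis using none by (cases as) (auto simp: side_def)
  qed
qed simp

section \<open>Sides of a signed set and heavy classes\<close>

lemma length_filter_distinct: "distinct p \<Longrightarrow> length (filter (\<lambda>a. a \<in> S) p) = card (S \<inter> set p)"
  by (metis Int_def distinct_card distinct_filter inf_commute set_filter)

lemma side_subset: "side x b \<subseteq> fst ` x"
  unfolding side_def by (auto intro: rev_image_eqI)

lemma fst_image_eq_sides: "fst ` x = side x True \<union> side x False"
proof (rule set_eqI)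
  fix a
  have "a \<in> fst ` x \<longleftrightarrow> (\<exists>c. (a, c) \<in> x)" by force
  then show "a \<in> fst ` x \<longleftrightarrow> a \<in> side x True \<union> side x False"
    by (auto simp: side_def ex_bool_eq)
qed

lemma side_mono: "x \<subseteq> y \<Longrightarrow> side x b \<subseteq> side y b"
  by (auto simp: side_def)

lemma side_negate: "side (negate ` x) b = side x (\<not> b)"
  by (simp add: side_def mem_negate_image)

lemma sides_disjoint: "consistent x \<Longrightarrow> side x b \<inter> side x (\<not> b) = {}"
  unfolding side_def using consistentD[of x _ b "\<not> b"] by blast

text \<open>The last clause breaks ties on a fully covered class, antipodally and monotonically.\<close>

definition heavy :: "'a set \<Rightarrow> ('a \<times> bool) set \<Rightarrow> bool \<Rightarrow> bool" where
  "heavy V x b \<longleftrightarrow> card V < 2 * card (side x b \<inter> V) \<or>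
     V \<subseteq> fst ` x \<and> 2 * card (side x b \<inter> V) = card V \<and> (SOME v. v \<in> V) \<in> side x b"

lemma card_sides_Int:
  assumes "consistent x" "finite V"
  shows "card (side x b \<inter> V) + card (side x (\<not> b) \<inter> V) = card (fst ` x \<inter> V)"
proof -
  have "fst ` x \<inter> V = (side x b \<inter> V) \<union> (side x (\<not> b) \<inter> V)"
    by (cases b) (auto simp: fst_image_eq_sides)
  then show ?thesis using assms sides_disjoint[of x b]
    by (subst card_Un_disjoint[symmetric]) auto
qed

lemma heavy_negate: "heavy V (negate ` x) b \<longleftrightarrow> heavy V x (\<not> b)"
  by (simp add: heavy_def side_negate image_image)

text \<open>If one of the two is a strict majority, the sides of \<open>y\<close> would together
  exceed \<open>V\<close>; if both are ties, the chosen vertex would lie on both sides of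
  \<open>y\<close>.\<close>

lemma not_heavy_both:
  assumes "consistent y" "x \<subseteq> y" "finite V" "heavy V x b" "heavy V y (\<not> b)"
  shows False
proof -
  have sum: "card (side y b \<inter> V) + card (side y (\<not> b) \<inter> V) \<le> card V"
    using card_sides_Int[OF assms(1,3), of b] card_mono[OF assms(3), of "fst ` y \<inter> V"] by simp
  have le: "card (side x b \<inter> V) \<le> card (side y b \<inter> V)"
    using side_mono[OF assms(2), of b] assms(3) by (intro card_mono) auto
  show False
  proof (cases "card V < 2 * card (side x b \<inter> V) \<or> card V < 2 * card (side y (\<not> b) \<inter> V)")
    case True
    then show False using sum le assms(4,5) by (auto simp: heavy_def)
  next
    case False
    then have "(SOME v. v \<in> V) \<in> side y b" "(SOME v. v \<in> V) \<in> side y (\<not> b)"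
      using assms(4,5) side_mono[OF assms(2), of b] by (auto simp: heavy_def)
    then show False using sides_disjoint[OF assms(1), of b] by blast
  qed
qed

lemma opposite_code: "opposite (2 * k + of_bool b) = 2 * k + of_bool (\<not> b)"
  by (auto simp: opposite_def)

text \<open>Tucker's lemma supplies a signed set with alternation length at least \<open>K\<close>
  and no heavy class. No class is then fully signed, so at most \<open>K\<close> vertices are
  signed: all of them alternate and exactly one vertex per class is deleted.\<close>

lemma fair_halving:
  fixes V :: "nat \<Rightarrow> 'a set"
  assumes "distinct p" and U: "(\<Union>j\<in>{1..m}. V j) = set p" and dis: "disjoint_family_on V {1..m}"
    and ne: "\<And>j. j \<in> {1..m} \<Longrightarrow> V j \<noteq> {}"
  obtains x b where "consistent x" "fst ` x \<subseteq> set p"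
    "alt_length x b p = card (side x True) + card (side x False)"
    "\<And>j. j \<in> {1..m} \<Longrightarrow> card (fst ` x \<inter> V j) = card (V j) - 1"
    "\<And>j c. j \<in> {1..m} \<Longrightarrow> 2 * card (side x c \<inter> V j) \<le> card (V j)"
proof -
  let ?n = "card (set p)"
  define K where "K = ?n - m"
  define ok where "ok x \<longleftrightarrow> consistent x \<and> x \<noteq> {} \<and> fst ` x \<subseteq> set p" for x
  have finV: "finite (V j)" if "j \<in> {1..m}" for j
    using U that by (metis List.finite_set UN_upper finite_subset)
  have cV: "1 \<le> card (V j)" if "j \<in> {1..m}" for j
    using ne[OF that] finV[OF that] by (simp add: Suc_le_eq card_gt_0_iff)
  have card_p: "card (X \<inter> set p) = (\<Sum>j\<in>{1..m}. card (X \<inter> V j))" for X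
  proof -
    have "X \<inter> set p = (\<Union>j\<in>{1..m}. X \<inter> V j)" using U by auto
    moreover have "card (\<Union>j\<in>{1..m}. X \<inter> V j) = (\<Sum>j\<in>{1..m}. card (X \<inter> V j))"
      using finV dis by (intro card_UN_disjoint) (auto simp: disjoint_family_on_def)
    ultimately show ?thesis by simp
  qed
  have n_sum: "?n = (\<Sum>j\<in>{1..m}. card (V j))"
    using card_p[of UNIV] by simp
  have K_sum: "K = (\<Sum>j\<in>{1..m}. card (V j) - 1)"
    using cV sum_subtractf_nat[of "{1..m}" "\<lambda>_. 1" "\<lambda>j. card (V j)"] by (simp add: K_def n_sum)
  have "m \<le> ?n"
    unfolding n_sum using sum_mono[of "{1..m}" "\<lambda>_. 1" "\<lambda>j. card (V j)"] cV by simp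
  show thesis
  proof (cases "K = 0")
    case True
    \<comment> \<open>All classes are single vertices, and deleting them leaves the empty signed
      set.\<close>
    then have V0: "card (V j) - 1 = 0" if "j \<in> {1..m}" for j using K_sum that by auto
    have "alt_length {} True p = 0" by (induction p) auto
    then show thesis
      using V0 by (intro that[of "{}" True]) (auto simp: consistent_def side_def)
  next
    case False
    define av where "av x = max (alt_length x True p) (alt_length x False p)" for x
    have "\<exists>x. ok x \<and> K \<le> av x \<and> (\<forall>j\<in>{1..m}. \<forall>b. \<not> heavy (V j) x b)"
    proof (rule ccontr)
      assume "\<not> ?thesis"
      then have H: "\<exists>j\<in>{1..m}. \<exists>b. heavy (V j) x b" if "ok x" "K \<le> av x" for x
        using that by blast
      define J where "J x = (LEAST j. j \<in> {1..m} \<and> (\<exists>b. heavy (V j) x b))" for x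
      have J: "J x \<in> {1..m} \<and> (\<exists>b. heavy (V (J x)) x b)" if "ok x" "K \<le> av x" for x
        using LeastI_ex[of "\<lambda>j. j \<in> {1..m} \<and> (\<exists>b. heavy (V j) x b)"] H[OF that]
        unfolding J_def by blast
      \<comment> \<open>Alternation lengths \<open>1\<close> to \<open>K - 1\<close> take the
        absolute values \<open>0\<close> to \<open>K - 2\<close>, class indices \<open>1\<close> to
        \<open>m\<close> take \<open>K - 1\<close> to \<open>K + m - 2\<close>. These are
        \<open>?n - 1\<close> values, one too few to avoid a complementary pair.
        \<open>K > 0\<close> keeps the subtraction exact.\<close>
      define mg where "mg x = (if av x < K then av x - 1 else K + J x - 2)" for x
      \<comment> \<open>The sign is that of the longer alternation, or the sign in which the class
        \<open>J x\<close> is heavy.\<close>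
      define neg where "neg x \<longleftrightarrow> (if av x < K then alt_length x True p < alt_length x False p
        else heavy (V (J x)) x False)" for x
      define l where "l x = 2 * mg x + of_bool (neg x)" for x
      have neq: "alt_length x True p \<noteq> alt_length x False p" if "ok x" for x
        using alt_length_neq[of x p True] that by (auto simp: ok_def)
      have av_pos: "1 \<le> av x" if "ok x" for x
        using neq[OF that] by (auto simp: av_def max_def)
      have ok_neg: "ok (negate ` x)" if "ok x" for x
      proof -
        have "inj_on fst (negate ` x)"
          using that by (auto simp: ok_def consistent_def inj_on_def)
        then show ?thesis using that by (auto simp: ok_def consistent_def image_image)
      qed
      have av_neg: "av (negate ` x) = av x" for x
        by (simp add: av_def alt_length_negate max.commute)
      have "heavy (V j) (negate ` x) True \<or> heavy (V j) (negate ` x) False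
          \<longleftrightarrow> heavy (V j) x True \<or> heavy (V j) x False" for j x
        by (auto simp: heavy_negate)
      then have J_neg: "J (negate ` x) = J x" for x
        by (simp add: J_def ex_bool_eq)
      have heavy_one: "heavy (V (J x)) x True \<longleftrightarrow> \<not> heavy (V (J x)) x False" if "ok x" "K \<le> av x" for x
        using J[OF that] not_heavy_both[of x x "V (J x)" True] that finV
        by (auto simp: ok_def ex_bool_eq)
      have neg_neg: "neg (negate ` x) \<longleftrightarrow> \<not> neg x" if "ok x" for x
        using neq[OF that] heavy_one[OF that]
        by (auto simp: neg_def av_neg J_neg alt_length_negate heavy_negate)
      have "antipodal_labelling (set p) l"
        unfolding antipodal_labelling_def l_def
        using neg_neg by (auto simp: ok_def mg_def av_neg J_neg opposite_code)
      moreover have "complementary_free (set p) l"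
        unfolding complementary_free_def
      proof (intro allI impI notI)
        fix x y assume y: "consistent y" "x \<noteq> {}" "x \<subseteq> y" "fst ` y \<subseteq> set p" "l y = opposite (l x)"
        have oky: "ok y" and okx: "ok x"
          using y consistent_subset[of y x] by (auto simp: ok_def)
        have "2 * mg y + of_bool (neg y) = 2 * mg x + of_bool (\<not> neg x)"
          using y(5) by (simp only: l_def opposite_code)
        then have eq: "mg y = mg x" "neg y \<longleftrightarrow> \<not> neg x"
          by (simp_all add: of_bool_def split: if_splits; presburger)+
        have le: "alt_length x c p \<le> alt_length y c p" for c by (rule alt_length_mono[OF y(3)])
        have avle: "av x \<le> av y" using le[of True] le[of False] by (auto simp: av_def)
        show False
        proof (cases "av y < K")
          case True
          \<comment> \<open>By monotonicity the sign attaining \<open>av x\<close> in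
            \<open>x\<close> also attains this value in \<open>y\<close>, so both have the same
            sign.\<close>
          then have "av x = av y" using eq(1) avle av_pos[OF okx] by (simp add: mg_def)
          then show False
            using eq(2) True avle le[of True] le[of False] neq[OF okx] neq[OF oky]
            by (auto simp: neg_def av_def max_def split: if_splits)
        next
          case y_large: False
          then have Jy: "J y \<in> {1..m}" using J[OF oky] by simp
          show False
          proof (cases "av x < K")
            case True
            then show False using eq(1) y_large Jy False av_pos[OF okx] by (auto simp: mg_def)
          next
            case x_large: False
            then have Jx: "J x \<in> {1..m}" using J[OF okx] by simp
            then have JJ: "J x = J y" using eq(1) Jy x_large y_large False by (auto simp: mg_def)
            \<comment> \<open>The same class would be heavy with opposite signs in comparable signed
              sets.\<close>
            show False
              using eq(2) heavy_one[OF okx] heavy_one[OF oky] x_large y_large finV[OF Jx]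
                not_heavy_both[OF y(1,3), of "V (J x)" True] not_heavy_both[OF y(1,3), of "V (J x)" False]
              by (auto simp: neg_def JJ)
          qed
        qed
      qed
      moreover have "l x < 2 * (?n - 1)" if "consistent x" "x \<noteq> {}" "fst ` x \<subseteq> set p" for x
      proof -
        have okx: "ok x" using that by (simp add: ok_def)
        have "mg x < ?n - 1"
        proof (cases "av x < K")
          case True
          then show ?thesis using av_pos[OF okx] by (auto simp: mg_def K_def)
        next
          case l: False
          then show ?thesis using J[OF okx] False \<open>m \<le> ?n\<close> by (auto simp: mg_def K_def)
        qed
        then show ?thesis by (simp add: l_def)
      qed
      moreover have "?n - 1 < ?n" using False by (auto simp: K_def)
      ultimately show False using octahedral_Tucker[of "set p" l "?n - 1"] by blast
    qed
    then obtain x where x: "ok x" "K \<le> av x" and light: "\<And>j b. j \<in> {1..m} \<Longrightarrow> \<not> heavy (V j) x b"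
      by blast
    have cons: "consistent x" and sub: "fst ` x \<subseteq> set p" using x by (auto simp: ok_def)
    have le_half: "2 * card (side x c \<inter> V j) \<le> card (V j)" if "j \<in> {1..m}" for j c
      using light[OF that, of c] by (auto simp: heavy_def)
    have le_cov: "card (fst ` x \<inter> V j) \<le> card (V j) - 1" if j: "j \<in> {1..m}" for j
    proof -
      \<comment> \<open>A fully signed class with neither side above half is an exact tie, and the
        tie-breaking vertex makes it heavy.\<close>
      have "fst ` x \<inter> V j \<noteq> V j"
      proof
        assume a: "fst ` x \<inter> V j = V j"
        then have "card (side x True \<inter> V j) + card (side x False \<inter> V j) = card (V j)"
          using card_sides_Int[OF cons finV[OF j], of True] by simp
        then have "2 * card (side x c \<inter> V j) = card (V j)" for c
          using le_half[OF j, of True] le_half[OF j, of False] by (cases c) auto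
        moreover have "(SOME v. v \<in> V j) \<in> V j" using ne[OF j] by (simp add: some_in_eq)
        then have "(SOME v. v \<in> V j) \<in> side x True \<or> (SOME v. v \<in> V j) \<in> side x False"
          using a fst_image_eq_sides[of x] by blast
        ultimately show False
          using light[OF j] a by (auto simp: heavy_def)
      qed
      then have "card (fst ` x \<inter> V j) < card (V j)"
        using finV[OF j] by (intro psubset_card_mono) auto
      then show ?thesis by simp
    qed
    have sides_p: "side x c \<inter> set p = side x c" for c using sub side_subset[of x c] by blast
    have total: "card (side x True) + card (side x False) = (\<Sum>j\<in>{1..m}. card (fst ` x \<inter> V j))"
      using card_sides_Int[OF cons, of "set p" True] card_p[of "fst ` x"] sides_p by simp
    obtain b where b: "av x = alt_length x b p" unfolding av_def max_def by metis
    have "av x \<le> card (side x True) + card (side x False)"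
      using alt_length_le_count[of x b p] assms(1) b by (simp add: length_filter_distinct sides_p)
    moreover have "(\<Sum>j\<in>{1..m}. card (fst ` x \<inter> V j)) \<le> K"
      unfolding K_sum by (intro sum_mono le_cov)
    \<comment> \<open>\<open>K\<close> is at most \<open>av x\<close>, which is at most the number
      of signed vertices, which is at most \<open>K\<close>.\<close>
    ultimately have eqs: "av x = card (side x True) + card (side x False)"
      "(\<Sum>j\<in>{1..m}. card (fst ` x \<inter> V j)) = (\<Sum>j\<in>{1..m}. card (V j) - 1)"
      using x(2) total K_sum by auto
    have "card (fst ` x \<inter> V j) = card (V j) - 1" if "j \<in> {1..m}" for j
      by (rule sum_mono_inv[OF eqs(2) le_cov that]) auto
    then show thesis by (rule that[OF cons sub eqs(1)[unfolded b] _ le_half])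
  qed
qed

section \<open>Powers of two\<close>

text \<open>Stability expressed by the entries between two members in the list, a form that suits
  \<open>filter\<close>.\<close>

definition gap_stable :: "nat \<Rightarrow> 'a list \<Rightarrow> 'a set \<Rightarrow> bool" where
  "gap_stable q p S \<longleftrightarrow> S \<subseteq> set p \<and>
     (\<forall>xs u ys v zs. p = xs @ u # ys @ v # zs \<longrightarrow> u \<in> S \<longrightarrow> v \<in> S \<longrightarrow> q \<le> Suc (length ys))"

lemma gap_stable_imp_stable_in_path:
  assumes "distinct p" "gap_stable q p S"
  shows "stable_in_path q p S"
proof -
  have *: "q \<le> j - i" if "i < j" "j < length p" "p ! i \<in> S" "p ! j \<in> S" for i j
  proof -
    have "drop (Suc i) p = take (j - Suc i) (drop (Suc i) p) @ p ! j # drop (Suc j) p"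
      using that id_take_nth_drop[of "j - Suc i" "drop (Suc i) p"] by simp
    then have "p = take i p @ p ! i # take (j - Suc i) (drop (Suc i) p) @ p ! j # drop (Suc j) p"
      using id_take_nth_drop[of i p] that by simp
    then have "q \<le> Suc (length (take (j - Suc i) (drop (Suc i) p)))"
      using assms(2) that unfolding gap_stable_def by blast
    then show ?thesis using that by simp
  qed
  have "q \<le> path_dist p u v" if "u \<in> S" "v \<in> S" "u \<noteq> v" for u v
  proof -
    have "u \<in> set p" "v \<in> set p" using that assms(2) by (auto simp: gap_stable_def)
    then obtain i j where ij: "i < length p" "u = p ! i" "j < length p" "v = p ! j"
      by (metis in_set_conv_nth)
    then have "i < j \<or> j < i" using that(3) by (metis nat_neq_iff)
    then show ?thesis
      using *[of i j] *[of j i] ij that path_dist_nth[OF assms(1) ij(1,3)] by auto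
  qed
  then show ?thesis using assms(2) by (auto simp: stable_in_path_def gap_stable_def)
qed

text \<open>Each member of \<open>S\<close> in \<open>l\<close> is followed inside \<open>l\<close>
  by a non-member, since the final \<open>v\<close> is itself in \<open>S\<close>.\<close>

lemma length_ge_twice_filter:
  assumes "successively (\<lambda>u v. \<not> (u \<in> S \<and> v \<in> S)) (l @ [v])" "v \<in> S"
  shows "2 * length (filter (\<lambda>a. a \<in> S) l) \<le> length l"
  using assms
proof (induction l rule: length_induct)
  case (1 l)
  show ?case
  proof (cases l)
    case (Cons a l')
    show ?thesis
    proof (cases "a \<in> S")
      case True
      then obtain b l'' where l': "l' = b # l''" using "1.prems" Cons by (cases l') auto
      then have "b \<notin> S" using True "1.prems" Cons by auto
      moreover have "2 * length (filter (\<lambda>a. a \<in> S) l'') \<le> length l''"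
        using "1.IH" "1.prems" Cons l' by (simp add: successively_Cons)
      ultimately show ?thesis using Cons l' True by simp
    next
      case False
      then have "2 * length (filter (\<lambda>a. a \<in> S) l') \<le> length l'"
        using "1.IH" "1.prems" Cons by (simp add: successively_Cons)
      then show ?thesis using False Cons by simp
    qed
  qed simp
qed

text \<open>From \<open>u\<close> up to just before \<open>v\<close> there are at least
  \<open>q\<close> members of \<open>S\<close>, each followed by a non-member, hence at least
  \<open>2 * q\<close> vertices.\<close>

lemma gap_stable_double:
  assumes "successively (\<lambda>u v. \<not> (u \<in> S \<and> v \<in> S)) p"
    and T: "gap_stable q (filter (\<lambda>a. a \<in> S) p) T"
  shows "gap_stable (2 * q) p T"
  unfolding gap_stable_def
proof (intro conjI allI impI)
  show "T \<subseteq> set p" using T by (auto simp: gap_stable_def)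
  fix xs u ys v zs assume p: "p = xs @ u # ys @ v # zs" and uv: "u \<in> T" "v \<in> T"
  let ?f = "filter (\<lambda>a. a \<in> S)"
  have uvS: "u \<in> S" "v \<in> S" using T uv by (auto simp: gap_stable_def)
  have "?f p = ?f xs @ u # ?f ys @ v # ?f zs" using p uvS by simp
  then have "q \<le> Suc (length (?f ys))" using T uv unfolding gap_stable_def by blast
  moreover have "successively (\<lambda>u v. \<not> (u \<in> S \<and> v \<in> S)) ((u # ys) @ [v])"
  proof -
    have "p = xs @ ((u # ys) @ [v]) @ zs" using p by simp
    then show ?thesis using assms(1) by (metis successively_append_iff)
  qed
  then have "2 * length (?f (u # ys)) \<le> length (u # ys)"
    using uvS(2) by (rule length_ge_twice_filter)
  ultimately show "2 * q \<le> Suc (length ys)" using uvS by simp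
qed

text \<open>If \<open>c i\<close> were at least \<open>d j + 2\<close>, every \<open>c k\<close>
  would be at least \<open>d j + 1\<close>, strictly for \<open>k = i\<close>, and every
  \<open>d k\<close> at most \<open>d j + 1\<close>, strictly for \<open>k = j\<close>; the sums
  would differ by at least two.\<close>

lemma balanced_families:
  fixes c d :: "nat \<Rightarrow> nat"
  assumes "\<And>i j. i < n \<Longrightarrow> j < n \<Longrightarrow> c i \<le> Suc (c j)" "\<And>i j. i < n \<Longrightarrow> j < n \<Longrightarrow> d i \<le> Suc (d j)"
    and "(\<Sum>i<n. c i) \<le> Suc (\<Sum>i<n. d i)" and ij: "i < n" "j < n"
  shows "c i \<le> Suc (d j)"
proof (rule ccontr)
  assume "\<not> ?thesis"
  then have big: "d j + 2 \<le> c i" by simp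
  have "(\<Sum>k<n. Suc (d j)) < (\<Sum>k<n. c k)"
  proof (rule sum_strict_mono_ex1)
    show "\<forall>k\<in>{..<n}. Suc (d j) \<le> c k" using assms(1)[OF ij(1)] big by fastforce
    show "\<exists>k\<in>{..<n}. Suc (d j) < c k" using ij big by (intro bexI[of _ i]) auto
  qed simp
  moreover have "(\<Sum>k<n. d k) < (\<Sum>k<n. Suc (d j))"
  proof (rule sum_strict_mono_ex1)
    show "\<forall>k\<in>{..<n}. d k \<le> Suc (d j)" using assms(2)[OF _ ij(2)] by simp
  qed (use ij in auto)
  ultimately show False using assms(3) by linarith
qed

text \<open>Exactness of the uncovered number fixes the total size covered in each half. As the
  halves differ by at most one vertex, so do these totals, which lets the balance pass through the
  induction.\<close>

lemma fair_power_of_two: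
  fixes V :: "nat \<Rightarrow> 'a set"
  assumes "path_partition (2 ^ t) p m V"
  shows "\<exists>S :: nat \<Rightarrow> 'a set. (\<forall>i<2 ^ t. gap_stable (2 ^ t) p (S i)) \<and> disjoint_family_on S {..<2 ^ t} \<and>
     (\<forall>j\<in>{1..m}. card (V j - (\<Union>i<2 ^ t. S i)) = 2 ^ t - 1) \<and>
     (\<forall>i<2 ^ t. \<forall>j\<in>{1..m}. (card (V j) + 1) div 2 ^ t \<le> card (S i \<inter> V j) + 1) \<and>
     (\<forall>i<2 ^ t. \<forall>i'<2 ^ t. card (S i) \<le> Suc (card (S i')))"
  using assms
proof (induction t arbitrary: p V)
  case 0
  then have U: "(\<Union>j\<in>{1..m}. V j) = set p" by (simp add: path_partition_def)
  then have "V j \<subseteq> set p" if "j \<in> {1..m}" for j using that by blast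
  then have "set p \<inter> V j = V j" "card (V j - set p) = 0" if "j \<in> {1..m}" for j
    using that by (metis Int_absorb1, metis Diff_eq_empty_iff card.empty)
  then show ?case
    by (intro exI[of _ "\<lambda>_. set p"]) (auto simp: gap_stable_def disjoint_family_on_def)
next
  case (Suc t)
  let ?q = "2 ^ t :: nat"
  have P: "distinct p" "(\<Union>j\<in>{1..m}. V j) = set p" "disjoint_family_on V {1..m}"
    and cV: "\<And>j. j \<in> {1..m} \<Longrightarrow> 2 * ?q - 1 \<le> card (V j)"
    using Suc.prems by (auto simp: path_partition_def)
  have q1: "1 \<le> ?q" by simp
  have finV: "finite (V j)" if "j \<in> {1..m}" for j
    using P(2) that by (metis List.finite_set UN_upper finite_subset)
  have cV1: "1 \<le> card (V j)" if "j \<in> {1..m}" for j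
    using cV[OF that] q1 by linarith
  then have "V j \<noteq> {}" if "j \<in> {1..m}" for j using that by fastforce
  then obtain x b where x: "consistent x" "fst ` x \<subseteq> set p"
    "alt_length x b p = card (side x True) + card (side x False)"
    "\<And>j. j \<in> {1..m} \<Longrightarrow> card (fst ` x \<inter> V j) = card (V j) - 1"
    "\<And>j c. j \<in> {1..m} \<Longrightarrow> 2 * card (side x c \<inter> V j) \<le> card (V j)"
    using fair_halving[OF P] by metis
  have side_p: "side x c \<inter> set p = side x c" "side x c \<subseteq> set p" for c
    using x(2) side_subset[of x c] by blast+
  have fin_side: "finite (side x c)" for c using finite_subset[OF side_p(2)] by simp
  have cnt: "length (filter (\<lambda>a. a \<in> side x c) p) = card (side x c)" for c
    using length_filter_distinct[OF P(1), of "side x c"] side_p by simp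
  have succ: "successively (\<lambda>u v. \<not> (u \<in> side x c \<and> v \<in> side x c)) p" for c
    by (rule successively_mono[OF alt_length_full_successively[of x b p]]) (use x(3) cnt in auto)
  have sides: "card (side x c) \<le> Suc (card (side x (\<not> c)))" for c
    using alt_length_le_twice[of x b p] x(3) cnt by (cases b; cases c) auto
  have halves: "card (side x c \<inter> V j) + card (side x (\<not> c) \<inter> V j) = card (V j) - 1"
    if "j \<in> {1..m}" for j c
    using card_sides_Int[OF x(1) finV[OF that], of c] x(4)[OF that] by simp
  \<comment> \<open>The other side has at most half of the class and one vertex is deleted, so this
    side has at least half rounded up, minus one.\<close>
  have half: "(card (V j) + 1) div 2 \<le> card (side x c \<inter> V j) + 1" if "j \<in> {1..m}" for j c
    using halves[OF that, of c] x(5)[OF that, of "\<not> c"] cV1[OF that] by linarith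
  let ?V = "\<lambda>c j. V j \<inter> side x c"
  let ?p = "\<lambda>c. filter (\<lambda>a. a \<in> side x c) p"
  have set_p: "set (?p c) = side x c" for c using side_p(1)[of c] by auto
  have part: "path_partition ?q (?p c) m (?V c)" for c
    unfolding path_partition_def
  proof (intro conjI ballI)
    show "(\<Union>j\<in>{1..m}. ?V c j) = set (?p c)"
      unfolding set_p using P(2) side_p(2)[of c] by blast
    show "disjoint_family_on (?V c) {1..m}" using P(3) by (auto simp: disjoint_family_on_def)
    fix j assume j: "j \<in> {1..m}"
    have "?q \<le> (card (V j) + 1) div 2" using cV[OF j] q1 by linarith
    then show "?q - 1 \<le> card (?V c j)" using half[OF j, of c] by (simp add: Int_commute)
  qed (use P in simp)
  let ?fair = "\<lambda>c S. (\<forall>i<?q. gap_stable ?q (?p c) (S i)) \<and> disjoint_family_on S {..<?q} \<and>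
     (\<forall>j\<in>{1..m}. card (?V c j - (\<Union>i<?q. S i)) = ?q - 1) \<and>
     (\<forall>i<?q. \<forall>j\<in>{1..m}. (card (?V c j) + 1) div ?q \<le> card (S i \<inter> ?V c j) + 1) \<and>
     (\<forall>i<?q. \<forall>i'<?q. card (S i) \<le> Suc (card (S i')))"
  have "\<forall>c. \<exists>S. ?fair c S" using Suc.IH[OF part] by (intro allI)
  from choice[OF this] obtain S where "\<forall>c. ?fair c (S c)" by (elim exE)
  then have S: "\<And>c i. i < ?q \<Longrightarrow> gap_stable ?q (?p c) (S c i)"
    "\<And>c. disjoint_family_on (S c) {..<?q}"
    "\<And>c j. j \<in> {1..m} \<Longrightarrow> card (?V c j - (\<Union>i<?q. S c i)) = ?q - 1"
    "\<And>c i j. i < ?q \<Longrightarrow> j \<in> {1..m} \<Longrightarrow> (card (?V c j) + 1) div ?q \<le> card (S c i \<inter> ?V c j) + 1"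
    "\<And>c i i'. i < ?q \<Longrightarrow> i' < ?q \<Longrightarrow> card (S c i) \<le> Suc (card (S c i'))"
    by simp_all
  have S_sub: "S c i \<subseteq> side x c" if "i < ?q" for c i
    using S(1)[OF that, of c] set_p by (auto simp: gap_stable_def)
  have S_disj: "S c i \<inter> S (\<not> c) i' = {}" if "i < ?q" "i' < ?q" for c i i'
    using S_sub[OF that(1), of c] S_sub[OF that(2), of "\<not> c"] sides_disjoint[OF x(1), of c] by blast
  have total: "(\<Sum>i<?q. card (S c i)) + m * (?q - 1) = card (side x c)" for c
  proof -
    let ?U = "\<Union>i<?q. S c i"
    have U: "?U \<subseteq> side x c" using S_sub by blast
    have "card ?U = (\<Sum>i<?q. card (S c i))"
      using S(2)[of c] finite_subset[OF S_sub fin_side]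
      by (intro card_UN_disjoint) (auto simp: disjoint_family_on_def)
    moreover have "side x c - ?U = (\<Union>j\<in>{1..m}. ?V c j - ?U)" using P(2) side_p(2)[of c] by blast
    moreover have "card (\<Union>j\<in>{1..m}. ?V c j - ?U) = (\<Sum>j\<in>{1..m}. card (?V c j - ?U))"
      using P(3) finV by (intro card_UN_disjoint) (auto simp: disjoint_family_on_def)
    moreover have "(\<Sum>j\<in>{1..m}. card (?V c j - ?U)) = m * (?q - 1)" using S(3) by simp
    moreover have "card (side x c) = card ?U + card (side x c - ?U)"
      using U fin_side[of c] by (metis card_Diff_subset card_mono finite_subset le_add_diff_inverse)
    ultimately show ?thesis by simp
  qed
  have balanced: "card (S c i) \<le> Suc (card (S c' i'))" if "i < ?q" "i' < ?q" for c c' i i'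
  proof (cases "c = c'")
    case False
    then have c': "c' = (\<not> c)" by simp
    have "(\<Sum>i<?q. card (S c i)) \<le> Suc (\<Sum>i<?q. card (S c' i))"
      using total[of c] total[of c'] sides[of c] c' by simp
    then show ?thesis
      using balanced_families[of ?q "\<lambda>i. card (S c i)" "\<lambda>i. card (S c' i)"] S(5) that by blast
  qed (use S(5) that in simp)
  \<comment> \<open>Indices below \<open>?q\<close> address the family of the positive side, the
    others that of the negative side.\<close>
  define R where "R i = S (i < ?q) (i mod ?q)" for i
  have mod: "i mod ?q < ?q" for i by simp
  have mod_eq: "i mod ?q = (if i < ?q then i else i - ?q)" if "i < 2 * ?q" for i
    using that by (simp add: mod_if)
  have UR: "(\<Union>i<2 * ?q. R i) = (\<Union>c. \<Union>i<?q. S c i)"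
  proof
    show "(\<Union>i<2 * ?q. R i) \<subseteq> (\<Union>c. \<Union>i<?q. S c i)" using mod by (fastforce simp: R_def)
    show "(\<Union>c. \<Union>i<?q. S c i) \<subseteq> (\<Union>i<2 * ?q. R i)"
    proof
      fix v assume "v \<in> (\<Union>c. \<Union>i<?q. S c i)"
      then obtain c i where ci: "i < ?q" "v \<in> S c i" by auto
      then have "v \<in> R (if c then i else i + ?q)" by (cases c) (simp_all add: R_def)
      then show "v \<in> (\<Union>i<2 * ?q. R i)" using ci by (intro UN_I) auto
    qed
  qed
  show ?case
  proof (intro exI[of _ R] conjI allI ballI impI)
    show "gap_stable (2 ^ Suc t) p (R i)" for i
      using gap_stable_double[OF succ S(1)[OF mod]] by (simp add: R_def)
    show "card (R i) \<le> Suc (card (R i'))" for i i'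
      unfolding R_def by (rule balanced[OF mod mod])
    show "disjoint_family_on R {..<2 ^ Suc t}"
      unfolding disjoint_family_on_def
    proof (intro ballI impI)
      fix i i' :: nat assume i: "i \<in> {..<2 ^ Suc t}" "i' \<in> {..<2 ^ Suc t}" "i \<noteq> i'"
      show "R i \<inter> R i' = {}"
      proof (cases "(i < ?q) = (i' < ?q)")
        case True
        then have "i mod ?q \<noteq> i' mod ?q" using i mod_eq[of i] mod_eq[of i'] by (auto split: if_splits)
        then show ?thesis
          using S(2)[of "i < ?q"] mod True unfolding R_def disjoint_family_on_def by simp
      next
        case False
        then have "(i' < ?q) = (\<not> (i < ?q))" by blast
        then show ?thesis unfolding R_def using S_disj[OF mod mod, of "i < ?q" i i'] by simp
      qed
    qed
  next
    fix j assume j: "j \<in> {1..m}"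
    let ?M = "\<lambda>c. ?V c j - (\<Union>i<?q. S c i)"
    have "(\<Union>i<?q. S c i) \<subseteq> side x c" for c using S_sub by blast
    from this[of True] this[of False]
    \<comment> \<open>Uncovered are the deleted vertex and \<open>?q - 1\<close> vertices on each
      side, which makes \<open>2 * ?q - 1\<close>.\<close>
    have "V j - (\<Union>i<2 * ?q. R i) = (V j - fst ` x) \<union> (?M True \<union> ?M False)"
      unfolding UR UNIV_bool fst_image_eq_sides using sides_disjoint[OF x(1), of True] by auto
    moreover have "card (V j - fst ` x) = 1"
      using x(4)[OF j] cV1[OF j] finV[OF j] card_Diff_subset_Int[of "V j" "fst ` x"]
      by (simp add: Int_commute)
    moreover have "card ((V j - fst ` x) \<union> (?M True \<union> ?M False)) =
        card (V j - fst ` x) + (card (?M True) + card (?M False))"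
    proof -
      have "?M True \<inter> ?M False = {}" using sides_disjoint[OF x(1), of True] by auto
      moreover have "(V j - fst ` x) \<inter> (?M True \<union> ?M False) = {}"
        using side_subset[of x True] side_subset[of x False] by blast
      ultimately show ?thesis using finV[OF j] by (simp add: card_Un_disjoint)
    qed
    ultimately have "card (V j - (\<Union>i<2 * ?q. R i)) = 1 + ((?q - 1) + (?q - 1))"
      using S(3)[OF j] by (simp only:)
    then show "card (V j - (\<Union>i<2 ^ Suc t. R i)) = 2 ^ Suc t - 1"
      unfolding power_Suc using q1 by linarith
    fix i :: nat
    let ?c = "i < ?q"
    have "(card (V j) + 1) div 2 ^ Suc t = (card (V j) + 1) div 2 div ?q"
      by (simp add: div_mult2_eq)
    also have "\<dots> \<le> (card (?V ?c j) + 1) div ?q"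
      using half[OF j, of ?c] by (intro div_le_mono) (simp add: Int_commute)
    also have "\<dots> \<le> card (S ?c (i mod ?q) \<inter> ?V ?c j) + 1" by (rule S(4)[OF mod j])
    also have "S ?c (i mod ?q) \<inter> ?V ?c j = R i \<inter> V j"
      using S_sub[OF mod, of ?c i] by (auto simp: R_def)
    finally show "(card (V j) + 1) div 2 ^ Suc t \<le> card (R i \<inter> V j) + 1" .
  qed
qed

section \<open>Stable Kneser hypergraphs\<close>

lemma exact_stable_sets:
  fixes U :: "nat \<Rightarrow> nat set"
  assumes q: "2 \<le> q"
    and chrom: "\<And>k n. 1 \<le> k \<Longrightarrow> q * k \<le> n \<Longrightarrow> int (chromatic_number (KG_stab q n k)) =
                 \<lceil>(real n - real q * (real k - 1)) / (real q - 1)\<rceil>"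
    and U: "(\<Union>j\<in>{1..m}. U j) = {1..N}" and dis: "disjoint_family_on U {1..m}"
    and cU: "\<And>j. j \<in> {1..m} \<Longrightarrow> card (U j) = q * t j + (q - 1)"
  obtains T :: "nat \<Rightarrow> nat set" where "\<And>i. i \<in> {1..q} \<Longrightarrow> stable_in_path q [1..<Suc N] (T i)"
    "disjoint_family_on T {1..q}"
    "\<And>i j. i \<in> {1..q} \<Longrightarrow> j \<in> {1..m} \<Longrightarrow> card (T i \<inter> U j) = t j"
proof -
  define k where "k = (\<Sum>j\<in>{1..m}. t j)"
  have finU: "finite (U j)" if "j \<in> {1..m}" for j
    using U that by (metis UN_upper finite_atLeastAtMost finite_subset)
  have card_split: "card F = (\<Sum>j\<in>{1..m}. card (F \<inter> U j))" if "F \<subseteq> {1..N}" for F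
  proof -
    have "F = (\<Union>j\<in>{1..m}. F \<inter> U j)" using U that by blast
    also have "card \<dots> = (\<Sum>j\<in>{1..m}. card (F \<inter> U j))"
      using finU dis by (intro card_UN_disjoint) (auto simp: disjoint_family_on_def)
    finally show ?thesis .
  qed
  have "N = (\<Sum>j\<in>{1..m}. card ({1..N} \<inter> U j))" using card_split[of "{1..N}"] by simp
  also have "\<dots> = (\<Sum>j\<in>{1..m}. q * t j + (q - 1))"
  proof (rule sum.cong)
    fix j assume j: "j \<in> {1..m}"
    then have "{1..N} \<inter> U j = U j" using U by blast
    then show "card ({1..N} \<inter> U j) = q * t j + (q - 1)" using cU[OF j] by simp
  qed simp
  finally have N: "N = q * k + m * (q - 1)" by (simp add: sum.distrib k_def sum_distrib_left)
  show thesis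
  proof (cases "k = 0")
    case True
    \<comment> \<open>Empty sets suffice here; the chromatic hypothesis is available only from
      \<open>k = 1\<close> on.\<close>
    then have "t j = 0" if "j \<in> {1..m}" for j using that by (auto simp: k_def)
    then show thesis
      by (intro that[of "\<lambda>_. {}"]) (auto simp: stable_in_path_def disjoint_family_on_def)
  next
    case False
    let ?H = "KG_stab q N k"
    let ?over = "\<lambda>F j. j \<in> {1..m} \<and> t j < card (F \<inter> U j)"
    \<comment> \<open>Colours \<open>1\<close> to \<open>m\<close> name an exceeded class;
      \<open>0\<close> is the extra colour.\<close>
    define f where "f F = (if \<exists>j. ?over F j then SOME j. ?over F j else 0)" for F
    have over: "?over F (f F)" if "\<exists>j. ?over F j" for F
      using someI_ex[OF that] that by (simp add: f_def)
    \<comment> \<open>The quotient equals \<open>m + 1 + 1 / (q - 1)\<close>, so its ceiling exceeds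
      \<open>m + 1\<close>.\<close>
    have "real m + 1 < (real N - real q * (real k - 1)) / (real q - 1)"
    proof -
      have "real N = real q * real k + real m * (real q - 1)" using N q by simp
      then have "real N - real q * (real k - 1) = (real m + 1) * (real q - 1) + 1"
        by (simp add: algebra_simps)
      then show ?thesis using q by (simp add: less_divide_eq)
    qed
    then have "int (m + 1) < int (chromatic_number ?H)"
      using chrom[of k N] False N by (simp add: less_ceiling_iff)
    then have "\<not> weak_coloring ?H (m + 1) f"
      unfolding chromatic_number_def using not_less_Least by (metis of_nat_less_iff)
    moreover have "f ` fst ?H \<subseteq> {..<m + 1}"
    proof
      fix c assume "c \<in> f ` fst ?H"
      then obtain F where "c = f F" by blast
      then show "c \<in> {..<m + 1}" using over[of F] by (cases "\<exists>j. ?over F j") (auto simp: f_def)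
    qed
    ultimately obtain e a where e: "e \<in> snd ?H" and a: "\<forall>F\<in>e. f F = a"
      unfolding weak_coloring_def by blast
    have eV: "e \<subseteq> KG_stab_vertices q N k" and ce: "card e = q" and de: "disjoint e"
      using e by (auto simp: KG_stab_def)
    have fine: "finite e" using ce q by (intro card_ge_0_finite) simp
    have no_over: "\<not> ?over F j" if F: "F \<in> e" for F j
    proof
      assume "?over F j"
      then have "?over F (f F)" by (intro over exI)
      then have "?over F a" using a F by simp
      then have a0: "a \<noteq> 0" and am: "a \<in> {1..m}" by auto
      have big: "t a + 1 \<le> card (G \<inter> U a)" if "G \<in> e" for G
      proof -
        have "f G \<noteq> 0" using a that a0 by simp
        then have "\<exists>j. ?over G j" by (auto simp: f_def split: if_splits)
        from over[OF this] show ?thesis using a that by simp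
      qed
      \<comment> \<open>The size \<open>q * t a + q - 1\<close> is one too small to hold
        \<open>t a + 1\<close> elements of each of \<open>q\<close> disjoint sets.\<close>
      have "q * (t a + 1) \<le> (\<Sum>G\<in>e. card (G \<inter> U a))"
        using sum_mono[of e "\<lambda>_. t a + 1" "\<lambda>G. card (G \<inter> U a)"] big ce by simp
      also have "\<dots> = card (\<Union>G\<in>e. G \<inter> U a)"
        using fine finU[OF am] de by (intro card_UN_disjoint[symmetric]) (auto simp: disjoint_def)
      also have "\<dots> \<le> card (U a)" using finU[OF am] by (intro card_mono) auto
      finally show False using cU[OF am] q by simp
    qed
    \<comment> \<open>No intersection exceeds \<open>t j\<close>, and both families sum to
      \<open>k\<close>.\<close>
    have exact: "card (F \<inter> U j) = t j" if F: "F \<in> e" and j: "j \<in> {1..m}" for F j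
    proof -
      have FV: "F \<subseteq> {1..N}" "card F = k" using eV F by (auto simp: KG_stab_vertices_def)
      show ?thesis
      proof (rule sum_mono_inv[of "\<lambda>j. card (F \<inter> U j)" "{1..m}" t])
        show "(\<Sum>j\<in>{1..m}. card (F \<inter> U j)) = sum t {1..m}"
          using card_split[OF FV(1)] FV(2) by (simp add: k_def)
        show "card (F \<inter> U i) \<le> t i" if "i \<in> {1..m}" for i
          using no_over[OF F, of i] that by auto
      qed (use j in auto)
    qed
    obtain h where h: "bij_betw h {1..q} e"
      using ex_bij_betw_nat_finite_1[OF fine] ce by auto
    have he: "h i \<in> e" if "i \<in> {1..q}" for i using h that by (auto simp: bij_betw_def)
    show thesis
    proof (rule that[of h])
      show "stable_in_path q [1..<Suc N] (h i)" if "i \<in> {1..q}" for i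
        using he[OF that] eV by (auto simp: KG_stab_vertices_def simp del: upt_Suc)
      show "disjoint_family_on h {1..q}"
        unfolding disjoint_family_on_def
      proof (intro ballI impI)
        fix i i' assume i: "i \<in> {1..q}" "i' \<in> {1..q}" "i \<noteq> i'"
        then have "h i \<noteq> h i'" using bij_betw_imp_inj_on[OF h] inj_onD by metis
        then show "h i \<inter> h i' = {}" using de he[OF i(1)] he[OF i(2)] by (simp add: disjoint_def)
      qed
      show "card (h i \<inter> U j) = t j" if "i \<in> {1..q}" "j \<in> {1..m}" for i j
        using exact[OF he[OF that(1)] that(2)] .
    qed
  qed
qed

section \<open>From exact intersections to the fair bounds\<close>

lemma floor_bound:
  assumes "(v + 1) div q \<le> c + 1"
  shows "\<lfloor>(real v + 1) / real q\<rfloor> - 1 \<le> int c"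
proof -
  have "\<lfloor>(real v + 1) / real q\<rfloor> = int ((v + 1) div q)"
    using floor_divide_of_nat_eq[of "v + 1" q] by (simp add: add.commute)
  then show ?thesis using assms by linarith
qed

lemma card_stable_Int_short_interval:
  assumes "stable_in_path q [1..<Suc N] F" "d < q"
  shows "card (F \<inter> {a<..a + d}) \<le> 1"
proof -
  have "x = y" if "x \<in> F \<inter> {a<..a + d}" "y \<in> F \<inter> {a<..a + d}" for x y
  proof (rule ccontr)
    assume "x \<noteq> y"
    then have "int q \<le> \<bar>int x - int y\<bar>" using assms(1) that unfolding stable_in_path_upt by blast
    then show False using that assms(2) by auto
  qed
  then show ?thesis by (simp add: card_le_Suc0_iff_eq)
qed

lemma fair_stable_sets_of_chromatic_number:
  fixes p :: "'a list"
  assumes q: "2 \<le> q"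
    and chrom: "\<And>k n. 1 \<le> k \<Longrightarrow> q * k \<le> n \<Longrightarrow> int (chromatic_number (KG_stab q n k)) =
                 \<lceil>(real n - real q * (real k - 1)) / (real q - 1)\<rceil>"
    and "path_partition q p m V"
  shows "\<exists>S. fair_stable_sets q p m V S"
proof -
  have P: "distinct p" "(\<Union>j\<in>{1..m}. V j) = set p" "disjoint_family_on V {1..m}"
    using assms(3) by (auto simp: path_partition_def)
  let ?n = "length p"
  \<comment> \<open>As \<open>q - 1\<close> is \<open>-1\<close> modulo \<open>q\<close>, this is
    the least padding that makes \<open>card (V j) + 1 + d j\<close> divisible by
    \<open>q\<close>.\<close>
  define d where "d j = ((q - 1) * (card (V j) + 1)) mod q" for j
  define t where "t j = (card (V j) + 1 + d j) div q - 1" for j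
  define D where "D j = (\<Sum>i\<in>{1..<j}. d i)" for j
  \<comment> \<open>The new vertices of a class form a block of fewer than \<open>q\<close>
    consecutive positions, which a stable set meets at most once.\<close>
  define I where "I j = {?n + D j<..?n + D j + d j}" for j
  define g where "g a = p ! (a - 1)" for a
  define B where "B j = {a \<in> {1..?n}. g a \<in> V j}" for j
  define N where "N = ?n + D (Suc m)"
  have dq: "d j < q" for j using q by (simp add: d_def)
  have vt: "card (V j) + 1 + d j = q * (t j + 1)" if "j \<in> {1..m}" for j
  proof -
    have "(card (V j) + 1 + d j) mod q = (card (V j) + 1 + (q - 1) * (card (V j) + 1)) mod q"
      unfolding d_def by (rule mod_add_right_eq)
    also have "card (V j) + 1 + (q - 1) * (card (V j) + 1) = q * (card (V j) + 1)"
      using q by (cases q) simp_all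
    finally have "q dvd card (V j) + 1 + d j" by (simp add: mod_eq_0_iff_dvd)
    then obtain r where r: "card (V j) + 1 + d j = q * r" by (elim dvdE)
    then have "r \<noteq> 0" by (cases r) auto
    moreover have "t j = r - 1" unfolding t_def r using q by simp
    ultimately show ?thesis using r by simp
  qed
  have D_Suc: "D (Suc j) = D j + d j" if "1 \<le> j" for j
    using that by (simp add: D_def)
  have D_mono: "D i \<le> D j" if "i \<le> j" for i j
    unfolding D_def using that by (intro sum_mono2) auto
  have g_bij: "bij_betw g {1..?n} (set p)"
  proof (rule bij_betw_imageI)
    show "inj_on g {1..?n}"
      using P(1) by (auto simp: inj_on_def g_def nth_eq_iff_index_eq)
    show "g ` {1..?n} = set p"
    proof
      show "g ` {1..?n} \<subseteq> set p" by (auto simp: g_def)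
      show "set p \<subseteq> g ` {1..?n}"
      proof
        fix v assume "v \<in> set p"
        then obtain i where "i < ?n" "v = p ! i" by (metis in_set_conv_nth)
        then show "v \<in> g ` {1..?n}" by (intro image_eqI[of _ _ "Suc i"]) (auto simp: g_def)
      qed
    qed
  qed
  have g_inj: "inj_on g {1..?n}" using g_bij by (simp add: bij_betw_def)
  have g_B: "g ` B j = V j" if "j \<in> {1..m}" for j
  proof -
    have "V j \<subseteq> g ` {1..?n}" using P(2) g_bij that by (auto simp: bij_betw_def)
    then show ?thesis unfolding B_def by auto
  qed
  have card_B: "card (B j) = card (V j)" if "j \<in> {1..m}" for j
    using g_B[OF that] card_image[of g "B j"] inj_on_subset[OF g_inj, of "B j"]
    by (metis (no_types, lifting) B_def mem_Collect_eq subsetI)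
  have fin_B: "finite (B j)" and B_I: "B j \<inter> I i = {}" and fin_I: "finite (I j)" for i j
    by (auto simp: B_def I_def)
  have U: "(\<Union>j\<in>{1..m}. B j \<union> I j) = {1..N}"
  proof -
    have "(\<Union>j\<in>{1..m}. B j) = {1..?n}"
    proof -
      have "\<exists>j\<in>{1..m}. g a \<in> V j" if "a \<in> {1..?n}" for a
        using bij_betwE[OF g_bij] that P(2) by blast
      then show ?thesis by (auto simp: B_def)
    qed
    moreover have "(\<Union>j\<in>{1..m'}. I j) = {?n<..?n + D (Suc m')}" for m'
    proof (induction m')
      case 0
      then show ?case by (simp add: D_def)
    next
      case (Suc m')
      have "{1..Suc m'} = insert (Suc m') {1..m'}" by auto
      then have "(\<Union>j\<in>{1..Suc m'}. I j) = I (Suc m') \<union> {?n<..?n + D (Suc m')}"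
        using Suc.IH by simp
      also have "\<dots> = {?n<..?n + D (Suc (Suc m'))}"
        using D_Suc[of "Suc m'"] by (auto simp: I_def)
      finally show ?case .
    qed
    ultimately show ?thesis by (auto simp: UN_Un_distrib N_def)
  qed
  have I_disj: "I i \<inter> I j = {}" if "i \<in> {1..m}" "j \<in> {1..m}" "i \<noteq> j" for i j
  proof -
    have *: "I i \<inter> I j = {}" if "1 \<le> i" "i < j" for i j
      using D_mono[of "Suc i" j] D_Suc[of i] that by (auto simp: I_def)
    show ?thesis using *[of i j] *[of j i] that by (cases "i < j") (auto simp: Int_commute)
  qed
  have dis: "disjoint_family_on (\<lambda>j. B j \<union> I j) {1..m}"
    unfolding disjoint_family_on_def
  proof (intro ballI impI)
    fix i j assume ij: "i \<in> {1..m}" "j \<in> {1..m}" "i \<noteq> j"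
    have "V i \<inter> V j = {}" using P(3) ij by (auto simp: disjoint_family_on_def)
    then have "B i \<inter> B j = {}" by (auto simp: B_def)
    then show "(B i \<union> I i) \<inter> (B j \<union> I j) = {}" using I_disj[OF ij] B_I[of i j] B_I[of j i] by blast
  qed
  have cU: "card (B j \<union> I j) = q * t j + (q - 1)" if "j \<in> {1..m}" for j
  proof -
    have "card (B j \<union> I j) = card (V j) + d j"
      using fin_B fin_I B_I[of j j] card_B[OF that] by (simp add: card_Un_disjoint I_def)
    then show ?thesis using vt[OF that] q by simp
  qed
  obtain T :: "nat \<Rightarrow> nat set" where T: "\<And>i. i \<in> {1..q} \<Longrightarrow> stable_in_path q [1..<Suc N] (T i)"
    "disjoint_family_on T {1..q}"
    "\<And>i j. i \<in> {1..q} \<Longrightarrow> j \<in> {1..m} \<Longrightarrow> card (T i \<inter> (B j \<union> I j)) = t j"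
    using exact_stable_sets[OF q chrom U dis cU] by metis
  define S where "S i = g ` (T i \<inter> {1..?n})" for i
  have S_V: "S i \<inter> V j = g ` (T i \<inter> B j)" for i j by (auto simp: S_def B_def)
  have "fair_stable_sets q p m V S"
    unfolding fair_stable_sets_def
  proof (intro conjI ballI)
    fix i assume i: "i \<in> {1..q}"
    have "q \<le> path_dist p u v" if uv: "u \<in> S i" "v \<in> S i" "u \<noteq> v" for u v
    proof -
      obtain a b where ab: "a \<in> T i" "a \<in> {1..?n}" "u = p ! (a - 1)" "b \<in> T i" "b \<in> {1..?n}" "v = p ! (b - 1)"
        using uv by (auto simp: S_def g_def)
      then have "a \<noteq> b" using uv by auto
      then have "int q \<le> \<bar>int a - int b\<bar>" using T(1)[OF i] ab unfolding stable_in_path_upt by blast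
      moreover have "path_dist p u v = nat \<bar>int (a - 1) - int (b - 1)\<bar>"
        using path_dist_nth[OF P(1), of "a - 1" "b - 1"] ab by auto
      ultimately show ?thesis using ab by (auto simp: of_nat_diff)
    qed
    moreover have "S i \<subseteq> set p" using g_bij by (auto simp: S_def bij_betw_def)
    ultimately show "stable_in_path q p (S i)" by (simp add: stable_in_path_def)
  next
    show "disjoint_family_on S {1..q}"
      unfolding disjoint_family_on_def
    proof (intro ballI impI)
      fix i i' assume i: "i \<in> {1..q}" "i' \<in> {1..q}" "i \<noteq> i'"
      then have "T i \<inter> T i' = {}" using T(2) by (auto simp: disjoint_family_on_def)
      then show "S i \<inter> S i' = {}"
        using g_inj unfolding S_def by (auto simp: inj_on_def)
    qed
  next
    fix j assume j: "j \<in> {1..m}"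
    let ?U = "B j \<union> I j" and ?T = "\<Union>i\<in>{1..q}. T i"
    have finU: "finite ?U" using fin_B fin_I by simp
    have "card (?U \<inter> ?T) = card (\<Union>i\<in>{1..q}. T i \<inter> ?U)" by (rule arg_cong[where f = card]) blast
    also have "\<dots> = (\<Sum>i\<in>{1..q}. card (T i \<inter> ?U))"
      using T(2) finU by (intro card_UN_disjoint) (auto simp: disjoint_family_on_def)
    also have "\<dots> = q * t j" using T(3) j by simp
    \<comment> \<open>The padded class has \<open>q * t j + q - 1\<close> elements, of which
      \<open>q * t j\<close> are covered; restricting to the original vertices cannot increase the
      remainder.\<close>
    finally have "card (?U - ?T) = q - 1"
      using card_Diff_subset_Int[of ?U ?T] finU cU[OF j] by simp
    moreover have "V j - (\<Union>i\<in>{1..q}. S i) \<subseteq> g ` (B j - ?T)"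
    proof
      fix v assume v: "v \<in> V j - (\<Union>i\<in>{1..q}. S i)"
      then obtain a where a: "a \<in> B j" "v = g a" using g_B[OF j] by blast
      then have "a \<in> {1..?n}" by (simp add: B_def)
      then have "a \<notin> ?T" using v a(2) unfolding S_def by blast
      then show "v \<in> g ` (B j - ?T)" using a by blast
    qed
    then have "card (V j - (\<Union>i\<in>{1..q}. S i)) \<le> card (B j - ?T)"
      using fin_B by (meson finite_Diff surj_card_le)
    moreover have "card (B j - ?T) \<le> card (?U - ?T)" using finU by (intro card_mono) auto
    ultimately show "card (V j - (\<Union>i\<in>{1..q}. S i)) \<le> q - 1" by simp
  next
    fix i j assume i: "i \<in> {1..q}" and j: "j \<in> {1..m}"
    have "card (S i \<inter> V j) = card (T i \<inter> B j)"
      unfolding S_V by (rule card_image) (rule inj_on_subset[OF g_inj], auto simp: B_def)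
    moreover have "card (T i \<inter> (B j \<union> I j)) = card (T i \<inter> B j) + card (T i \<inter> I j)"
      using fin_B fin_I B_I[of j j] by (subst card_Un_disjoint[symmetric]) (auto simp: Int_Un_distrib)
    ultimately have c: "card (S i \<inter> V j) + card (T i \<inter> I j) = t j" using T(3)[OF i j] by simp
    have "(card (V j) + 1) div q \<le> card (S i \<inter> V j) + 1"
    \<comment> \<open>Without padding nothing is lost and the quotient is \<open>t j + 1\<close>.
      With padding at most one vertex is lost, but the quotient is at most
      \<open>t j\<close>.\<close>
    proof (cases "d j = 0")
      case True
      then have "card (T i \<inter> I j) = 0" by (simp add: I_def)
      moreover have "(card (V j) + 1) div q = t j + 1" using vt[OF j] True q by simp
      ultimately show ?thesis using c by simp
    next
      case False
      have "card (T i \<inter> I j) \<le> 1"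
        unfolding I_def by (rule card_stable_Int_short_interval[OF T(1)[OF i] dq])
      moreover have "(card (V j) + 1) div q < t j + 1"
        using vt[OF j] False q by (simp add: div_less_iff_less_mult mult.commute)
      ultimately show ?thesis using c by simp
    qed
    then show "\<lfloor>(real (card (V j)) + 1) / real q\<rfloor> - 1 \<le> int (card (S i \<inter> V j))"
      by (rule floor_bound)
  qed
  then show ?thesis by blast
qed

lemma balanced_fair_stable_sets:
  assumes "q = 2 ^ t" "path_partition q p m V"
  shows "\<exists>S. fair_stable_sets q p m V S \<and>
    (\<forall>i\<in>{1..q}. \<forall>i'\<in>{1..q}. \<bar>int (card (S i)) - int (card (S i'))\<bar> \<le> 1)"
proof -
  obtain S :: "nat \<Rightarrow> 'a set" where S: "\<forall>i<q. gap_stable q p (S i)" "disjoint_family_on S {..<q}"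
    "\<forall>j\<in>{1..m}. card (V j - (\<Union>i<q. S i)) = q - 1"
    "\<forall>i<q. \<forall>j\<in>{1..m}. (card (V j) + 1) div q \<le> card (S i \<inter> V j) + 1"
    "\<forall>i<q. \<forall>i'<q. card (S i) \<le> Suc (card (S i'))"
    using fair_power_of_two[of t p m V] assms by auto
  have dist: "distinct p" using assms(2) by (simp add: path_partition_def)
  let ?S = "\<lambda>i. S (i - 1)"
  have lt: "i - 1 < q" if "i \<in> {1..q}" for i using that by auto
  have "(\<lambda>i. i - 1) ` {1..q} = {..<q}" by (auto simp: image_iff intro!: bexI[of _ "Suc _"])
  then have UN: "(\<Union>i\<in>{1..q}. ?S i) = (\<Union>i<q. S i)" by (metis image_image)
  have "fair_stable_sets q p m V ?S"
    unfolding fair_stable_sets_def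
  proof (intro conjI ballI)
    show "stable_in_path q p (?S i)" if "i \<in> {1..q}" for i
      using gap_stable_imp_stable_in_path[OF dist] S(1) lt[OF that] by blast
    show "disjoint_family_on ?S {1..q}"
      unfolding disjoint_family_on_def
    proof (intro ballI impI)
      fix i i' assume i: "i \<in> {1..q}" "i' \<in> {1..q}" "i \<noteq> i'"
      then have "i - 1 \<noteq> i' - 1" by auto
      then show "?S i \<inter> ?S i' = {}"
        using S(2) lt[OF i(1)] lt[OF i(2)] by (simp add: disjoint_family_on_def)
    qed
    show "card (V j - (\<Union>i\<in>{1..q}. ?S i)) \<le> q - 1" if "j \<in> {1..m}" for j
      unfolding UN using S(3) that by simp
    show "\<lfloor>(real (card (V j)) + 1) / real q\<rfloor> - 1 \<le> int (card (?S i \<inter> V j))"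
      if "i \<in> {1..q}" "j \<in> {1..m}" for i j
      using S(4) lt[OF that(1)] that(2) by (intro floor_bound) blast
  qed
  moreover have "\<bar>int (card (?S i)) - int (card (?S i'))\<bar> \<le> 1" if "i \<in> {1..q}" "i' \<in> {1..q}" for i i'
  proof -
    have "card (?S i) \<le> Suc (card (?S i'))" "card (?S i') \<le> Suc (card (?S i))"
      using S(5) lt[OF that(1)] lt[OF that(2)] by blast+
    then show ?thesis by linarith
  qed
  ultimately show ?thesis by blast
qed

theorem theorem7p2:
  shows "(\<forall>q::nat. q \<ge> 2 \<longrightarrow>
            (\<forall>k n. k \<ge> 1 \<longrightarrow> n \<ge> q * k \<longrightarrow>
               int (chromatic_number (KG_stab q n k)) =
                 \<lceil>(real n - real q * (real k - 1)) / (real q - 1)\<rceil>) \<longrightarrow>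
            (\<forall>(p :: 'a list) m V. path_partition q p m V \<longrightarrow>
               (\<exists>S. fair_stable_sets q p m V S)))
       \<and> (\<forall>q::nat. q \<ge> 2 \<longrightarrow> (\<exists>t. q = 2 ^ t) \<longrightarrow>
            (\<forall>(p :: 'a list) m V. path_partition q p m V \<longrightarrow>
               (\<exists>S. fair_stable_sets q p m V S \<and>
                  (\<forall>i\<in>{1..q}. \<forall>i'\<in>{1..q}.
                     \<bar>int (card (S i)) - int (card (S i'))\<bar> \<le> 1))))"
proof (intro conjI allI impI)
  fix q m :: nat and p :: "'a list" and V
  assume "2 \<le> q" "\<forall>k n. k \<ge> 1 \<longrightarrow> n \<ge> q * k \<longrightarrow> int (chromatic_number (KG_stab q n k)) =
    \<lceil>(real n - real q * (real k - 1)) / (real q - 1)\<rceil>" "path_partition q p m V"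
  then show "\<exists>S. fair_stable_sets q p m V S"
    by (intro fair_stable_sets_of_chromatic_number) auto
next
  fix q m :: nat and p :: "'a list" and V
  assume "\<exists>t. q = 2 ^ t" "path_partition q p m V"
  then show "\<exists>S. fair_stable_sets q p m V S \<and>
    (\<forall>i\<in>{1..q}. \<forall>i'\<in>{1..q}. \<bar>int (card (S i)) - int (card (S i'))\<bar> \<le> 1)"
    using balanced_fair_stable_sets by blast
qed

end
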